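(* Let $n\ge2$ and let $D$ be an open connected set with $C^1$ boundary such that $\left(-\frac9{20},\frac9{20}\right)^n\Subset D\Subset\left(-\frac12,\frac12\right)^n$ and such that $\Omega=\mathbb{R}^n\setminus\bigcup_{m\in\mathbb{Z}^n}(m+\overline D)$ is connected. Let $$H(y,p)=\frac{a(y)|p|^2}{2}\qquad\text{for }(y,p)\in\mathbb{R}^n\times\mathbb{R}^n,$$ where $a\in C(\mathbb{R}^n)$ is a given $\mathbb{Z}^n$-periodic function such that $a=1$ on $\overline\Omega$, $a>1$ in $\mathbb{R}^n\setminus\overline\Omega$, and $$\int_{-1/2}^{1/2}\frac{1}{a\left(\frac{e_2}{4}+se_1\right)}\,ds<\frac14 .$$ Let $I=\{m^2e_1:\ m\in\mathbb{N}\}$ with $\mathbb{N}=\{1,2,\dots\}$, and let $$W=\mathbb{R}^n\setminus\bigcup_{m\in\mathbb{Z}^n\setminus I}(m+\overline D),\qquad W_\varepsilon=\varepsilon W .$$ Then the modulus of continuity $\omega_0$ associated with $I$ through $\frac{|I_k|}{k}=\omega_0\left(\frac1k\right)$, $I_k=I\cap[-k,k]^n$, $k\in\mathbb{N}$, is $\omega_0(\varepsilon)=\varepsilon^{1/2}$. Let $g(x)=-x_1$ for $x\in\mathbb{R}^n$. For $\varepsilon>0$ let $w^\varepsilon$ be the unique viscosity solution of the state-constraint problem $$w^\varepsilon_t+H\left(\tfrac x\varepsilon,Dw^\varepsilon\right)\le0\ \text{ in }W_\varepsilon\times(0,\infty),\quad w^\varepsilon_t+H\left(\tfrac x\varepsilon,Dw^\varepsilon\right)\ge0\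 \text{ on }\overline W_\varepsilon\times(0,\infty),\quad w^\varepsilon(\cdot,0)=g\ \text{ on }\overline W_\varepsilon,$$ and let $u$ be the unique viscosity solution of $u_t+\overline H(Du)=0$ in $\mathbb{R}^n\times(0,\infty)$, $u(\cdot,0)=g$ on $\mathbb{R}^n$, where $\overline H=\overline H_\Omega$ is the effective Hamiltonian of the state-constraint cell problem on $\overline\Omega$. Then there exists $\delta=\delta(a)>0$ such that, for $\varepsilon\in\left(0,\frac14\right)$, $$w^\varepsilon\left(\frac{\varepsilon e_2}{2},1\right)\le u\left(\frac{\varepsilon e_2}{2},1\right)-\delta\varepsilon^{1/2}+\varepsilon=-\frac12-\delta\varepsilon^{1/2}+\varepsilon .$$
   Context: $\{e_1,\dots,e_n\}$ is the canonical basis of $\mathbb{R}^n$, and $|I_k|$ denotes the cardinality of $I_k$. The index set $I$ marks the cells in which the hole is missing. The paper's usage of $\omega_0$ is that if $|I_k|$ is of the size $k^\theta$ as $k\to\infty$ for some $\theta\in(0,1)$, then $\omega_0(s)=s^{1-\theta}$ for $s>0$. State-constraint viscosity solutions: $w^\varepsilon$, continuous on $\overline W_\varepsilon\times[0,\infty)$, is a viscosity subsolution in $W_\varepsilon\times(0,\infty)$ in the usual sense and a supersolution on $\overline W_\varepsilon\times(0,\infty)$, i.e. test functions touching from below relative to $\overline W_\varepsilon\times(0,\infty)$ satisfy the inequality $\ge0$. Equivalently, with $L(y,v)=\sup_p(p\cdot v-H(y,p))=\frac{|v|^2}{2a(y)}$, $$w^\varepsilon(x,t)=\inf\left\{\int_0^tL\left(\tfrac{\xi(s)}\varepsilon,\dot\xi(s)\right)ds+g(\xi(0)):\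 \xi\in\mathrm{AC}([0,t];\overline W_\varepsilon),\ \xi(t)=x\right\},$$ where $\mathrm{AC}(J;U)$ denotes the set of absolutely continuous curves $J\to U$. Effective Hamiltonian: for $p\in\mathbb{R}^n$, $\overline H(p)$ is the unique constant for which the problem $H(y,p+Dv)\le\overline H(p)$ in $\Omega$, $H(y,p+Dv)\ge\overline H(p)$ on $\overline\Omega$ (state-constraint viscosity sense) has a $\mathbb{Z}^n$-periodic viscosity solution $v$. *)

theory Defs
  imports "HOL-Analysis.Analysis" "HOL-Library.Landau_Symbols"
begin

definition compactly_contained :: "'a::metric_space set \<Rightarrow> 'a set \<Rightarrow> bool" where
  "compactly_contained A B \<longleftrightarrow> compact (closure A) \<and> closure A \<subseteq> interior B"

definition C1_gradient :: "('a::euclidean_space \<Rightarrow> real) \<Rightarrow> ('a \<Rightarrow> 'a) \<Rightarrow> bool" where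
  "C1_gradient \<phi> G \<longleftrightarrow> (\<forall>x. GDERIV \<phi> x :> G x) \<and> continuous_on UNIV G"

text \<open>
  Near each boundary point, after a rotation that makes \<open>\<nu>\<close> the last coordinate direction,
  the set is the epigraph of a \<open>C\<^sup>1\<close> function of the remaining coordinates, i.e. of the
  projection \<open>y - (y \<bullet> \<nu>) *\<^sub>R \<nu>\<close> onto the hyperplane orthogonal to \<open>\<nu>\<close>.
\<close>
definition C1_boundary :: "'a::euclidean_space set \<Rightarrow> bool" where
  "C1_boundary D \<longleftrightarrow>
     (\<forall>x\<in>frontier D. \<exists>r>0. \<exists>\<nu> \<gamma> \<Gamma>. norm \<nu> = 1 \<and> C1_gradient \<gamma> \<Gamma> \<and>
        D \<inter> ball x r = {y \<in> ball x r. y \<bullet> \<nu> > \<gamma> (y - (y \<bullet> \<nu>) *\<^sub>R \<nu>)})"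


definition integer_lattice :: "(real^'n) set" where
  "integer_lattice = {m. \<forall>i. m $ i \<in> \<int>}"

definition cube :: "real \<Rightarrow> (real^'n) set" where
  "cube r = {x. \<forall>i. - r < x $ i \<and> x $ i < r}"

text \<open>
  The space with a copy of the hole \<open>closure D\<close> removed from every integer cell except
  those in \<open>J\<close>; in particular \<open>perforated D {}\<close> is the fully periodic domain.
\<close>
definition perforated :: "(real^'n) set \<Rightarrow> (real^'n) set \<Rightarrow> (real^'n) set" where
  "perforated D J = UNIV - (\<Union>m \<in> integer_lattice - J. (\<lambda>y. m + y) ` closure D)"

definition square_cells :: "real^'n \<Rightarrow> (real^'n) set" where
  "square_cells e = {(real m)\<^sup>2 *\<^sub>R e | m::nat. m \<ge> 1}"

definition truncated :: "(real^'n) set \<Rightarrow> nat \<Rightarrow> (real^'n) set" where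
  "truncated I k = I \<inter> {x. \<forall>i. - real k \<le> x $ i \<and> x $ i \<le> real k}"

text \<open>
  The relation \<open>|I\<^sub>k| / k = \<omega>(1/k)\<close> between a cell count and a power function is
  understood up to multiplicative constants: \<open>|I\<^sub>k|\<close> is of the size \<open>k powr \<theta>\<close>, and then
  \<open>\<omega> s = s powr (1 - \<theta>)\<close>. Only the values of \<open>\<omega>\<close> at positive arguments matter.
\<close>
definition hole_modulus :: "(real^'n) set \<Rightarrow> (real \<Rightarrow> real) \<Rightarrow> bool" where
  "hole_modulus I \<omega> \<longleftrightarrow>
     (\<exists>\<theta>\<in>{0<..<1}. (\<lambda>k. real (card (truncated I k))) \<in> \<Theta>(\<lambda>k. real k powr \<theta>) \<and>
        (\<forall>s>0. \<omega> s = s powr (1 - \<theta>)))"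


text \<open>
  Viscosity inequalities for \<open>F z (Du z) = 0\<close>. Touching is local and relative to \<open>S\<close>;
  for non-open \<open>S\<close> this makes the supersolution property the state-constraint one. In the
  evolution problems below, \<open>z = (x, t)\<close> and the gradient is the pair of the spatial gradient
  and the time derivative.
\<close>
definition viscosity_subsolution ::
    "('a::euclidean_space \<Rightarrow> 'a \<Rightarrow> real) \<Rightarrow> 'a set \<Rightarrow> ('a \<Rightarrow> real) \<Rightarrow> bool" where
  "viscosity_subsolution F S u \<longleftrightarrow>
     (\<forall>\<phi> G. \<forall>z\<in>S. C1_gradient \<phi> G \<longrightarrow>
        (\<forall>\<^sub>F y in at z within S. u y - \<phi> y \<le> u z - \<phi> z) \<longrightarrow> F z (G z) \<le> 0)"

definition viscosity_supersolution ::
    "('a::euclidean_space \<Rightarrow> 'a \<Rightarrow> real) \<Rightarrow> 'a set \<Rightarrow> ('a \<Rightarrow> real) \<Rightarrow> bool" where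
  "viscosity_supersolution F S u \<longleftrightarrow>
     (\<forall>\<phi> G. \<forall>z\<in>S. C1_gradient \<phi> G \<longrightarrow>
        (\<forall>\<^sub>F y in at z within S. u y - \<phi> y \<ge> u z - \<phi> z) \<longrightarrow> F z (G z) \<ge> 0)"

text \<open>
  State-constraint problem for \<open>u\<^sub>t + H(x, Du) = 0\<close> on \<open>U\<close>. For \<open>U = UNIV\<close> there is no
  boundary and this is the ordinary Cauchy problem.
\<close>
definition cauchy_solution ::
    "(real^'n \<Rightarrow> real^'n \<Rightarrow> real) \<Rightarrow> (real^'n) set \<Rightarrow> (real^'n \<Rightarrow> real)
      \<Rightarrow> ((real^'n) \<times> real \<Rightarrow> real) \<Rightarrow> bool" where
  "cauchy_solution H U g u \<longleftrightarrow>
     continuous_on (closure U \<times> {0..}) u \<and>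
     viscosity_subsolution (\<lambda>(x, t) (q, \<tau>). \<tau> + H x q) (U \<times> {0<..}) u \<and>
     viscosity_supersolution (\<lambda>(x, t) (q, \<tau>). \<tau> + H x q) (closure U \<times> {0<..}) u \<and>
     (\<forall>x\<in>closure U. u (x, 0) = g x)"

definition cell_problem_solvable ::
    "(real^'n \<Rightarrow> real^'n \<Rightarrow> real) \<Rightarrow> (real^'n) set \<Rightarrow> real^'n \<Rightarrow> real \<Rightarrow> bool" where
  "cell_problem_solvable H U p c \<longleftrightarrow>
     (\<exists>v. continuous_on (closure U) v \<and>
        (\<forall>m\<in>integer_lattice. \<forall>y\<in>closure U. v (y + m) = v y) \<and>
        viscosity_subsolution (\<lambda>y q. H y (p + q) - c) U v \<and>
        viscosity_supersolution (\<lambda>y q. H y (p + q) - c) (closure U) v)"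

text \<open>
  The constant is unique by the comparison principle, so for a coercive periodic \<open>H\<close> and a
  connected periodic domain this determines the effective Hamiltonian.
\<close>
definition effective_hamiltonian ::
    "(real^'n \<Rightarrow> real^'n \<Rightarrow> real) \<Rightarrow> (real^'n) set \<Rightarrow> (real^'n \<Rightarrow> real) \<Rightarrow> bool" where
  "effective_hamiltonian H U Hbar \<longleftrightarrow> (\<forall>p. cell_problem_solvable H U p (Hbar p))"

definition quadratic_hamiltonian :: "(real^'n \<Rightarrow> real) \<Rightarrow> real^'n \<Rightarrow> real^'n \<Rightarrow> real" where
  "quadratic_hamiltonian a y p = a y * (norm p)\<^sup>2 / 2"

end

theory Submission
  imports Defs
begin

text \<open>
  A viscosity subsolution cannot increase along a segment by more than the integral of the
  Lagrangian; this is the only consequence of the subsolution property that is used.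
  Along the corridor lines, where the coordinate \<open>x\<^sub>j\<close> is a half-integer, it
  gives \<open>Hbar p \<ge> (p\<^sub>i)\<^sup>2 / 2\<close>, while a minimum point of the corrector gives
  \<open>Hbar p \<le> |p|\<^sup>2 / 2\<close>; hence \<open>u (x, t) = - x\<^sub>1 - t / 2\<close>. Since \<open>u\<close> is not assumed to have any
  growth, the lower bound first needs a quadratic minorant, which is read off backwards from the
  subsolution property on segments that all end at one far point \<open>(0, T)\<close>.

  For \<open>w\<close> one follows the corridor at speed 1, which costs \<open>\<epsilon> / 2\<close> per cell, except that in the
  cells without a hole one descends to height \<open>1/4\<close>, crosses at speed 2 and climbs back. This detour
  also takes time \<open>\<epsilon>\<close>, but costs only \<open>\<epsilon> (1/4 + A)\<close>, where \<open>A < 1/4\<close> is the integral of \<open>1 / a\<close>.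
  About \<open>\<epsilon> powr (-1/2)\<close> such cells are met before the horizontal distance \<open>1\<close> is covered.
\<close>

subsection \<open>Subsolutions along segments\<close>

lemma C1_gradientI:
  assumes "\<And>x. GDERIV \<phi> x :> G x" "continuous_on UNIV G"
  shows "C1_gradient \<phi> G"
  using assms by (simp add: C1_gradient_def)

text \<open>Test functions must be differentiable everywhere, so the antiderivative is taken on the
  whole real line.\<close>

lemma continuous_antiderivative:
  fixes l :: "real \<Rightarrow> real"
  assumes "continuous_on UNIV l"
  obtains \<psi> where "\<And>s. (\<psi> has_real_derivative l s) (at s)"
proof -
  have "\<exists>F. \<forall>x::real. -\<infinity> < ereal x \<longrightarrow> ereal x < \<infinity> \<longrightarrow> (F has_vector_derivative l x) (at x)"
    by (rule einterval_antiderivative)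
      (use assms in \<open>auto simp: continuous_on_eq_continuous_at\<close>)
  then show ?thesis
    using that by (auto simp: has_real_derivative_iff_has_vector_derivative)
qed

text \<open>The test function for motion along \<open>V\<close>: \<open>\<sigma>\<close> is the
  parameter along the segment and \<open>d\<close> the deviation from it. When
  \<open>V \<bullet> \<nu> = 1\<close>, \<open>d\<close> is constant in direction \<open>V\<close>,
  so the quadratic penalty adds nothing to the derivative along \<open>V\<close>.\<close>

lemma segment_function_gradient:
  fixes z V \<nu> :: "'a::euclidean_space"
  assumes \<psi>: "\<And>s. (\<psi> has_real_derivative l s) (at s)"
  defines "\<sigma> \<equiv> \<lambda>x. (x - z) \<bullet> \<nu>"
  defines "d \<equiv> \<lambda>x. x - z - \<sigma> x *\<^sub>R V"
  shows "GDERIV (\<lambda>x. \<psi> (\<sigma> x) + K * (norm (d x))\<^sup>2 + exp (k * (\<sigma> x - c))) x :>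
      (l (\<sigma> x) + k * exp (k * (\<sigma> x - c))) *\<^sub>R \<nu> + (2 * K) *\<^sub>R (d x - (d x \<bullet> V) *\<^sub>R \<nu>)"
proof -
  have [derivative_intros]: "((\<lambda>x. \<psi> (\<sigma> x)) has_derivative (\<lambda>h. l (\<sigma> x) * (h \<bullet> \<nu>))) (at x)"
  proof -
    have "(\<psi> has_derivative (*) (l (\<sigma> x))) (at (\<sigma> x))"
      using \<psi>[of "\<sigma> x"] by (simp add: has_field_derivative_def)
    moreover have "(\<sigma> has_derivative (\<lambda>h. h \<bullet> \<nu>)) (at x)"
      unfolding \<sigma>_def by (auto intro!: derivative_eq_intros)
    ultimately show ?thesis
      using diff_chain_at[of \<sigma> _ x \<psi>] by (simp add: o_def)
  qed
  show ?thesis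
    unfolding gderiv_def power2_norm_eq_inner
    apply (subst d_def) 
    apply (subst d_def) 
    apply (rule derivative_eq_intros refl | simp add: \<sigma>_def)+
    apply (rule ext)
    apply (simp add: d_def \<sigma>_def inner_simps algebra_simps inner_commute)
    done
qed

text \<open>Maximise \<open>u\<close> minus the test function over a closed tube around the segment.
  An interior maximum contradicts the subsolution inequality and the penalties exclude the side and
  the far end, so the maximum lies on the initial face near \<open>z\<close>. Only points with
  \<open>0 < \<sigma> x\<close> must lie in \<open>S\<close>, which lets a segment start at time
  0.\<close>

lemma subsolution_increment_le:
  fixes u :: "'a::euclidean_space \<Rightarrow> real" and z V \<nu> :: 'a and l :: "real \<Rightarrow> real"
  defines "\<sigma> \<equiv> \<lambda>x. (x - z) \<bullet> \<nu>"
  defines "d \<equiv> \<lambda>x. x - z - \<sigma> x *\<^sub>R V"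
  assumes sub: "viscosity_subsolution F S u"
    and V\<nu>: "V \<bullet> \<nu> = 1" and "r > 0" "T \<ge> 0"
    and cont: "continuous_on {x. 0 \<le> \<sigma> x \<and> \<sigma> x \<le> T + r \<and> norm (d x) \<le> r} u"
    and tube: "\<And>x. 0 < \<sigma> x \<Longrightarrow> \<sigma> x < T + r \<Longrightarrow> norm (d x) < r \<Longrightarrow> x \<in> S"
    and bound: "\<And>x q. 0 < \<sigma> x \<Longrightarrow> \<sigma> x < T + r \<Longrightarrow> norm (d x) < r \<Longrightarrow> F x q \<le> 0 \<Longrightarrow> q \<bullet> V \<le> l (\<sigma> x)"
    and l: "continuous_on UNIV l"
  shows "u (z + T *\<^sub>R V) - u z \<le> integral {0..T} l"
proof -
  obtain \<psi> where \<psi>: "\<And>s. (\<psi> has_real_derivative l s) (at s)"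
    using continuous_antiderivative[OF l] by blast
  have int: "integral {0..T} l = \<psi> T - \<psi> 0"
  proof (rule integral_unique, rule fundamental_theorem_of_calculus)
    show "(\<psi> has_vector_derivative l x) (at x within {0..T})" for x
      using \<psi>[of x] by (simp add: has_real_derivative_iff_has_vector_derivative has_vector_derivative_at_within)
  qed fact
  have c\<psi>: "continuous_on A \<psi>" for A
    using \<psi> by (meson DERIV_isCont continuous_at_imp_continuous_on)
  define C where "C = {x. 0 \<le> \<sigma> x \<and> \<sigma> x \<le> T + r \<and> norm (d x) \<le> r}"
  have cs: "continuous_on A \<sigma>" and cd: "continuous_on A d" for A
    unfolding \<sigma>_def d_def by (intro continuous_intros)+
  have "bounded C"
  proof -
    have "norm x \<le> norm z + (T + r) * norm V + r" if "x \<in> C" for x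
    proof -
      have "x = z + \<sigma> x *\<^sub>R V + d x" by (simp add: d_def)
      then have "norm x \<le> norm z + norm (\<sigma> x *\<^sub>R V) + norm (d x)"
        by (metis norm_triangle_ineq norm_triangle_le add_right_mono order_trans)
      also have "norm (\<sigma> x *\<^sub>R V) \<le> (T + r) * norm V"
        using that by (auto simp: C_def intro!: mult_right_mono)
      finally show ?thesis using that by (auto simp: C_def)
    qed
    then show ?thesis by (meson bounded_iff)
  qed
  moreover have "closed C"
    unfolding C_def
    by (intro closed_Collect_conj closed_Collect_le continuous_intros cs cd)
  ultimately have C: "compact C" by (simp add: compact_eq_bounded_closed)
  have zT: "\<sigma> (z + s *\<^sub>R V) = s" "d (z + s *\<^sub>R V) = 0" for s
    using V\<nu> by (simp_all add: \<sigma>_def d_def)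
  have zC: "z \<in> C" using zT[of 0] \<open>r > 0\<close> \<open>T \<ge> 0\<close> by (simp add: C_def)
  have zTC: "z + T *\<^sub>R V \<in> C" using zT[of T] \<open>r > 0\<close> \<open>T \<ge> 0\<close> by (simp add: C_def)
  have cu: "continuous_on C u" using cont by (simp add: C_def)
  have "compact ((\<lambda>x. u x - \<psi> (\<sigma> x)) ` C)"
    by (intro compact_continuous_image continuous_intros cu C continuous_on_compose2[OF c\<psi>[of UNIV] cs]) auto
  then obtain M where "\<forall>y \<in> (\<lambda>x. u x - \<psi> (\<sigma> x)) ` C. norm y \<le> M"
    using compact_imp_bounded bounded_iff by metis
  then have M: "\<bar>u x - \<psi> (\<sigma> x)\<bar> \<le> M" if "x \<in> C" for x
    using that by simp
  have "u (z + T *\<^sub>R V) - u z \<le> \<psi> T - \<psi> 0 + \<eta>" if "\<eta> > 0" for \<eta>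
  proof -
    define \<eta>' where "\<eta>' = \<eta> / 2"
    have "\<eta>' > 0" using that by (simp add: \<eta>'_def)
    obtain \<rho>0 where \<rho>0: "\<rho>0 > 0" "\<And>x. x \<in> C \<Longrightarrow> dist x z < \<rho>0 \<Longrightarrow> dist (u x) (u z) < \<eta>'"
      using cu zC \<open>\<eta>' > 0\<close> unfolding continuous_on_iff by metis
    define \<rho> where "\<rho> = min \<rho>0 r"
    have \<rho>: "\<rho> > 0" "\<rho> \<le> r" "\<rho> \<le> \<rho>0" using \<rho>0 \<open>r > 0\<close> by (auto simp: \<rho>_def)
    \<comment> \<open>\<open>N\<close> exceeds the bound \<open>2 * M + 1\<close> on the penalties
      at a maximum point, while \<open>1 / N\<close>, the value of the exponential at
      \<open>z + T *\<^sub>R V\<close>, stays below the allowed error.\<close>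
    define N where "N = max (2 * M + 2) (1 / \<eta>')"
    have M0: "M \<ge> 0" using M[OF zC] by linarith
    have N: "N \<ge> 2 * M + 2" "1 / N \<le> \<eta>'" "N > 1"
    proof -
      show "N \<ge> 2 * M + 2" by (simp add: N_def)
      then show "N > 1" using M0 by linarith
      have "1 / \<eta>' \<le> N" by (simp add: N_def)
      then show "1 / N \<le> \<eta>'" using \<open>\<eta>' > 0\<close> \<open>N > 1\<close>
        by (simp add: field_simps)
    qed
    define k where "k = 2 * ln N / r"
    have "k > 0" using N \<open>r > 0\<close> by (simp add: k_def)
    define c where "c = T + r / 2"
    \<comment> \<open>\<open>exp (k * (\<sigma> - c))\<close> is at most \<open>\<eta>'\<close> up to \<open>\<sigma> = T\<close> but keeps the maximum away from the
      end \<open>\<sigma> = T + r\<close> of the tube; being strictly increasing, it also makes the test strict.\<close>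
    have kT: "exp (k * (T - c)) = 1 / N"
      using N \<open>r > 0\<close> by (simp add: k_def c_def exp_minus inverse_eq_divide)
    have kTr: "exp (k * (T + r - c)) = N"
      using N \<open>r > 0\<close> by (simp add: k_def c_def)
    \<comment> \<open>At deviation \<open>\<rho>\<close> the quadratic penalty equals
      \<open>2 * M + 2\<close>, more than a maximum point can carry. On the initial face this keeps
      the maximum within the continuity radius around \<open>z\<close>.\<close>
    define K where "K = (2 * M + 2) / \<rho>\<^sup>2"
    have K: "K > 0" using M0 \<rho> by (simp add: K_def)
    define \<phi> where "\<phi> x = \<psi> (\<sigma> x) + K * (norm (d x))\<^sup>2 + exp (k * (\<sigma> x - c))" for x
    define G where "G x = (l (\<sigma> x) + k * exp (k * (\<sigma> x - c))) *\<^sub>R \<nu> + (2 * K) *\<^sub>R (d x - (d x \<bullet> V) *\<^sub>R \<nu>)" for x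
    have grad: "C1_gradient \<phi> G"
    proof (rule C1_gradientI)
      show "GDERIV \<phi> x :> G x" for x
        unfolding \<phi>_def G_def \<sigma>_def d_def by (rule segment_function_gradient) (rule \<psi>)
      show "continuous_on UNIV G"
        unfolding G_def
        by (intro continuous_intros cs cd continuous_on_compose2[OF l cs]) auto
    qed
    have "continuous_on C (\<lambda>x. u x - \<phi> x)"
      unfolding \<phi>_def
      by (intro continuous_intros cu cs cd continuous_on_compose2[OF c\<psi>[of UNIV] cs]) auto
    then obtain x where x: "x \<in> C" "\<And>y. y \<in> C \<Longrightarrow> u y - \<phi> y \<le> u x - \<phi> x"
      using continuous_attains_sup[OF C, of "\<lambda>x. u x - \<phi> x"] zC by blast
    have top: "u (z + T *\<^sub>R V) - \<psi> T - 1 / N \<le> u x - \<phi> x"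
      using x(2)[OF zTC] by (simp add: \<phi>_def zT kT)
    moreover have "1 / N < 1" using N by simp
    ultimately have pen: "K * (norm (d x))\<^sup>2 + exp (k * (\<sigma> x - c)) < 2 * M + 1"
      using M[OF x(1)] M[OF zTC] unfolding \<phi>_def zT by linarith
    have "K * \<rho>\<^sup>2 = 2 * M + 2" using \<rho> by (simp add: K_def)
    then have "K * (norm (d x))\<^sup>2 < K * \<rho>\<^sup>2"
      using pen exp_gt_zero[of "k * (\<sigma> x - c)"] by linarith
    then have dx: "norm (d x) < \<rho>"
      using K \<rho> by (simp add: power_less_imp_less_base)
    have "exp (k * (\<sigma> x - c)) < exp (k * (T + r - c))"
      using pen N K zero_le_power2[of "norm (d x)"] unfolding kTr
      by (smt (verit) mult_nonneg_nonneg)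
    then have sx: "\<sigma> x < T + r" using \<open>k > 0\<close> by simp
    \<comment> \<open>Otherwise testing at \<open>x\<close> bounds the derivative along
      \<open>V\<close> by \<open>l\<close>, although it equals \<open>l\<close> plus the positive
      derivative of the exponential.\<close>
    have "\<sigma> x = 0"
    proof (rule ccontr)
      assume "\<sigma> x \<noteq> 0"
      then have s0: "0 < \<sigma> x" using x(1) by (auto simp: C_def)
      define O' where "O' = {y. 0 < \<sigma> y \<and> \<sigma> y < T + r \<and> norm (d y) < r}"
      have "open O'"
        unfolding O'_def by (intro open_Collect_conj open_Collect_less continuous_intros cs cd)
      moreover have "x \<in> O'" using s0 sx dx \<rho> by (simp add: O'_def)
      moreover have "O' \<subseteq> C" by (auto simp: O'_def C_def)
      ultimately have "\<forall>\<^sub>F y in at x within S. u y - \<phi> y \<le> u x - \<phi> x"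
        unfolding eventually_at_topological using x(2) by blast
      moreover have "x \<in> S" using \<open>x \<in> O'\<close> tube by (simp add: O'_def)
      ultimately have "F x (G x) \<le> 0"
        using sub grad unfolding viscosity_subsolution_def by blast
      then have "G x \<bullet> V \<le> l (\<sigma> x)" using bound \<open>x \<in> O'\<close> by (simp add: O'_def)
      moreover have "G x \<bullet> V = l (\<sigma> x) + k * exp (k * (\<sigma> x - c))"
        using V\<nu> by (simp add: G_def inner_simps inner_commute)
      ultimately show False using \<open>k > 0\<close> by (simp add: mult_le_0_iff)
    qed
    moreover from this have "d x = x - z" by (simp add: d_def)
    ultimately have "dist (u x) (u z) < \<eta>'" using \<rho>0(2)[OF x(1)] dx \<rho> by (simp add: dist_norm)
    moreover have "u x - \<phi> x \<le> u x - \<psi> 0"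
    proof -
      have "0 \<le> K * (norm (d x))\<^sup>2" using K by simp
      then show ?thesis
        using exp_ge_zero[of "k * (0 - c)"] unfolding \<phi>_def \<open>\<sigma> x = 0\<close> by linarith
    qed
    ultimately show ?thesis using top N(2) unfolding dist_real_def \<eta>'_def by linarith
  qed
  then have "u (z + T *\<^sub>R V) - u z \<le> \<psi> T - \<psi> 0"
    by (meson field_le_epsilon)
  then show ?thesis by (simp add: int)
qed

text \<open>By compactness the segment has a neighbourhood of some width \<open>e\<close> inside
  \<open>U\<close>. A tube point is reached from the segment by overshooting at most
  \<open>r\<close> in direction \<open>V\<close> and deviating at most \<open>r\<close>, hence the
  radius \<open>e / (norm V + 1)\<close>. The tube extends past the far end but not behind the
  starting face.\<close>

lemma open_segment_tube:
  fixes z V \<nu> :: "'a::euclidean_space"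
  defines "\<sigma> \<equiv> \<lambda>x. (x - z) \<bullet> \<nu>"
  defines "d \<equiv> \<lambda>x. x - z - \<sigma> x *\<^sub>R V"
  assumes "open U" and seg: "\<And>s. 0 \<le> s \<Longrightarrow> s \<le> T \<Longrightarrow> z + s *\<^sub>R V \<in> U" and "T \<ge> 0"
  obtains r where "r > 0"
    "\<And>x. 0 \<le> \<sigma> x \<Longrightarrow> \<sigma> x \<le> T + r \<Longrightarrow> norm (d x) \<le> r \<Longrightarrow> x \<in> U"
proof -
  define A where "A = (\<lambda>s. z + s *\<^sub>R V) ` {0..T}"
  have "A \<noteq> {}" "compact A" "A \<subseteq> U"
    using seg \<open>T \<ge> 0\<close> by (auto simp: A_def intro!: compact_continuous_image continuous_intros)
  then obtain e where e: "e > 0" "{x. infdist x A \<le> e} \<subseteq> U"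
    using compact_in_open_separated \<open>open U\<close> by metis
  define r where "r = e / (norm V + 1)"
  have nV: "norm V + 1 > 0" using norm_ge_zero[of V] by linarith
  have r: "r > 0" "r * (norm V + 1) = e"
    using e nV by (auto simp: r_def)
  show ?thesis
  proof (rule that[OF r(1)])
    fix x assume x: "0 \<le> \<sigma> x" "\<sigma> x \<le> T + r" "norm (d x) \<le> r"
    define s where "s = min (\<sigma> x) T"
    have "z + s *\<^sub>R V \<in> A" using x \<open>T \<ge> 0\<close> by (auto simp: A_def s_def)
    then have "infdist x A \<le> dist x (z + s *\<^sub>R V)" by (rule infdist_le)
    also have "x - (z + s *\<^sub>R V) = (\<sigma> x - s) *\<^sub>R V + d x"
      by (simp add: d_def algebra_simps)
    then have "dist x (z + s *\<^sub>R V) \<le> \<bar>\<sigma> x - s\<bar> * norm V + norm (d x)"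
      unfolding dist_norm by (metis norm_scaleR norm_triangle_ineq)
    also have "\<dots> \<le> r * norm V + r"
      using x r by (intro add_mono mult_right_mono) (auto simp: s_def)
    also have "\<dots> = e" using r(2) by (simp add: algebra_simps)
    finally show "x \<in> U" using e by auto
  qed
qed

text \<open>Now the bound depends on position and not only on the parameter. In a thin enough tube
  \<open>l\<close> is within \<open>\<eta>\<close> of its value on the segment, at a total price of
  \<open>T * \<eta>\<close>.\<close>

lemma subsolution_along_segment:
  fixes u :: "'a::euclidean_space \<Rightarrow> real" and z V \<nu> :: 'a and l :: "'a \<Rightarrow> real"
  assumes sub: "viscosity_subsolution F S u"
    and V\<nu>: "V \<bullet> \<nu> = 1" and T: "T \<ge> 0"
    and U: "open U" "\<And>s. 0 \<le> s \<Longrightarrow> s \<le> T \<Longrightarrow> z + s *\<^sub>R V \<in> U"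
    and cont: "continuous_on {x\<in>U. 0 \<le> (x - z) \<bullet> \<nu>} u"
    and US: "\<And>x. x \<in> U \<Longrightarrow> 0 < (x - z) \<bullet> \<nu> \<Longrightarrow> x \<in> S"
    and bound: "\<And>x q. x \<in> U \<Longrightarrow> F x q \<le> 0 \<Longrightarrow> q \<bullet> V \<le> l x"
    and l: "continuous_on UNIV l"
  shows "u (z + T *\<^sub>R V) - u z \<le> integral {0..T} (\<lambda>s. l (z + s *\<^sub>R V))"
proof -
  have lc: "continuous_on A (\<lambda>s. l (z + s *\<^sub>R V))" for A :: "real set"
    by (intro continuous_intros continuous_on_compose2[OF l]) auto
  have le: "u (z + T *\<^sub>R V) - u z \<le> integral {0..T} (\<lambda>s. l (z + s *\<^sub>R V)) + T * \<eta>" if "\<eta> > 0" for \<eta>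
  proof -
    let ?l = "\<lambda>s. l (z + s *\<^sub>R V) + \<eta>"
    define U' where "U' = U \<inter> {x. \<bar>l x - l (z + ((x - z) \<bullet> \<nu>) *\<^sub>R V)\<bar> < \<eta>}"
    have "open U'" unfolding U'_def
      by (intro open_Int U open_Collect_less continuous_intros l continuous_on_compose2[OF l]) auto
    moreover have "z + s *\<^sub>R V \<in> U'" if "0 \<le> s" "s \<le> T" for s
      using U(2)[OF that] V\<nu> \<open>\<eta> > 0\<close> by (simp add: U'_def)
    ultimately obtain r where r: "r > 0"
      "\<And>x. 0 \<le> (x - z) \<bullet> \<nu> \<Longrightarrow> (x - z) \<bullet> \<nu> \<le> T + r \<Longrightarrow>
        norm (x - z - ((x - z) \<bullet> \<nu>) *\<^sub>R V) \<le> r \<Longrightarrow> x \<in> U'"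
      using open_segment_tube[where U = U' and \<nu> = \<nu>] T by metis
    have "u (z + T *\<^sub>R V) - u z \<le> integral {0..T} ?l"
    proof (rule subsolution_increment_le[OF sub V\<nu> r(1) T])
      show "continuous_on {x. 0 \<le> (x - z) \<bullet> \<nu> \<and> (x - z) \<bullet> \<nu> \<le> T + r \<and>
          norm (x - z - ((x - z) \<bullet> \<nu>) *\<^sub>R V) \<le> r} u"
        by (rule continuous_on_subset[OF cont]) (use r(2) in \<open>auto simp: U'_def\<close>)
      fix x assume x: "0 < (x - z) \<bullet> \<nu>" "(x - z) \<bullet> \<nu> < T + r"
        "norm (x - z - ((x - z) \<bullet> \<nu>) *\<^sub>R V) < r"
      then have xU: "x \<in> U'" using r(2)[of x] by simp
      then show "x \<in> S" using US x by (simp add: U'_def)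
      fix q assume "F x q \<le> 0"
      then have "q \<bullet> V \<le> l x" using bound xU by (simp add: U'_def)
      then show "q \<bullet> V \<le> ?l ((x - z) \<bullet> \<nu>)"
        using xU unfolding U'_def by auto
    next
      show "continuous_on UNIV ?l" by (intro continuous_intros lc)
    qed
    also have "\<dots> = integral {0..T} (\<lambda>s. l (z + s *\<^sub>R V)) + T * \<eta>"
      using T by (subst integral_add) (auto intro: integrable_continuous_real lc)
    finally show ?thesis .
  qed
  show ?thesis
  proof (rule field_le_epsilon)
    fix e :: real assume "e > 0"
    have "T * (e / (T + 1)) \<le> e"
      using T \<open>e > 0\<close> by (simp add: field_simps)
    with le[of "e / (T + 1)"] show "u (z + T *\<^sub>R V) - u z \<le> integral {0..T} (\<lambda>s. l (z + s *\<^sub>R V)) + e"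
      using T \<open>e > 0\<close> by simp
  qed
qed

lemma subsolution_along_segment_const:
  fixes u :: "'a::euclidean_space \<Rightarrow> real" and z V \<nu> :: 'a
  assumes "viscosity_subsolution F S u" "V \<bullet> \<nu> = 1" "T \<ge> 0" "open U"
    "\<And>s. 0 \<le> s \<Longrightarrow> s \<le> T \<Longrightarrow> z + s *\<^sub>R V \<in> U"
    "continuous_on {x\<in>U. 0 \<le> (x - z) \<bullet> \<nu>} u"
    "\<And>x. x \<in> U \<Longrightarrow> 0 < (x - z) \<bullet> \<nu> \<Longrightarrow> x \<in> S"
    "\<And>x q. x \<in> U \<Longrightarrow> F x q \<le> 0 \<Longrightarrow> q \<bullet> V \<le> b"
  shows "u (z + T *\<^sub>R V) - u z \<le> T * b"
  using subsolution_along_segment[OF assms(1-7), of "\<lambda>_. b"] assms(3,8) by simp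

subsection \<open>Perforated domains and the cell problem\<close>

lemma mem_perforated_iff:
  "x \<in> perforated D J \<longleftrightarrow> (\<forall>m\<in>integer_lattice - J. x - m \<notin> closure D)"
proof -
  have "x \<in> (\<lambda>y. m + y) ` closure D \<longleftrightarrow> x - m \<in> closure D" for m
    by (auto intro: image_eqI[of _ _ "x - m"])
  then show ?thesis by (simp add: perforated_def)
qed

lemma closed_sublattice:
  fixes M :: "(real^'n) set"
  assumes "M \<subseteq> integer_lattice"
  shows "closed M"
proof (rule discrete_imp_closed[of 1])
  have "y = x" if "x \<in> M" "y \<in> M" "dist y x < 1" for x y
  proof (rule vec_eq_iff[THEN iffD2], rule allI)
    fix i
    have "y $ i - x $ i \<in> \<int>"
      using subsetD[OF assms that(1)] subsetD[OF assms that(2)] by (simp add: integer_lattice_def)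
    moreover have "\<bar>y $ i - x $ i\<bar> < 1"
      using that(3) component_le_norm_cart[of "y - x" i] by (simp add: dist_norm)
    ultimately show "y $ i = x $ i"
      using Ints_nonzero_abs_less1[of "y $ i - x $ i"] by simp
  qed
  then show "\<forall>x\<in>M. \<forall>y\<in>M. dist y x < 1 \<longrightarrow> y = x" by blast
qed simp

text \<open>The removed set is the sum of the compact set \<open>closure D\<close> and a closed set
  of lattice points, hence closed.\<close>

lemma open_perforated:
  assumes "bounded D"
  shows "open (perforated D J)"
proof -
  have "closed (\<Union>x\<in>closure D. \<Union>m\<in>integer_lattice - J. {x + m})"
    using assms by (intro compact_closed_sums) (auto simp: compact_closure intro: closed_sublattice)
  moreover have "perforated D J = - (\<Union>x\<in>closure D. \<Union>m\<in>integer_lattice - J. {x + m})"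
  proof -
    have "(\<lambda>y. m + y) ` closure D = (\<Union>x\<in>closure D. {x + m})" for m by (auto simp: add.commute)
    then show ?thesis unfolding perforated_def by blast
  qed
  ultimately show ?thesis by (simp add: open_closed)
qed

lemma integer_lattice_add: "m \<in> integer_lattice \<Longrightarrow> k \<in> integer_lattice \<Longrightarrow> m + k \<in> integer_lattice"
  and integer_lattice_uminus: "m \<in> integer_lattice \<Longrightarrow> - m \<in> integer_lattice"
  by (auto simp: integer_lattice_def)

lemma perforated_translate:
  assumes "m \<in> integer_lattice" "x \<in> perforated D {}"
  shows "m + x \<in> perforated D {}"
  unfolding mem_perforated_iff
proof
  fix k :: "real^'a" assume "k \<in> integer_lattice - {}"
  then have "k - m \<in> integer_lattice" using assms(1) integer_lattice_add[of k "- m"] integer_lattice_uminus[of m] by simp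
  then have "x - (k - m) \<notin> closure D" using assms(2) by (auto simp: mem_perforated_iff)
  then show "m + x - k \<notin> closure D" by (simp add: algebra_simps)
qed

lemma closure_perforated_translate:
  assumes "m \<in> integer_lattice" "x \<in> closure (perforated D {})"
  shows "m + x \<in> closure (perforated D {})"
proof -
  have "m + x \<in> closure ((\<lambda>y. m + y) ` perforated D {})"
    using assms(2) unfolding closure_translation by (rule imageI)
  also have "\<dots> \<subseteq> closure (perforated D {})"
    using perforated_translate[OF assms(1)] by (intro closure_mono) auto
  finally show ?thesis .
qed

lemma compactly_contained_cube:
  assumes "compactly_contained D (cube r)"
  shows "closure D \<subseteq> cube r" "bounded D"
proof -
  have "compact (closure D)" and *: "closure D \<subseteq> interior (cube r)"
    using assms by (simp_all add: compactly_contained_def)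
  then show "bounded D" by (meson bounded_subset closure_subset compact_imp_bounded)
  show "closure D \<subseteq> cube r" using * interior_subset by (rule subset_trans)
qed

section \<open>Corridors, cells without a hole, and bounds on the effective Hamiltonian\<close>

lemma half_integer_not_near:
  fixes k t :: real
  assumes "k \<in> \<int>" "t - 1/2 \<in> \<int>"
  shows "\<not> (- (1/2) < t - k \<and> t - k < 1/2)"
proof -
  obtain i j where "k = of_int i" "t - 1/2 = of_int j" using assms by (auto elim!: Ints_cases)
  then have "t - k = of_int (j - i) + 1/2" by simp
  moreover have "j - i \<ge> 0 \<or> j - i \<le> - 1" by linarith
  then have "real_of_int (j - i) \<ge> 0 \<or> real_of_int (j - i) \<le> - 1"
    using of_int_le_iff[where 'a = real, of "j - i" "- 1"] by simp
  ultimately show ?thesis by linarith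
qed

text \<open>Each hole lies in an open unit cube centred at a lattice point, whose faces sit at
  half-integers. So these hyperplanes are corridors avoiding all holes, whatever \<open>J\<close>
  is.\<close>

lemma half_integer_mem_perforated:
  fixes x :: "real^'n"
  assumes "closure D \<subseteq> cube (1/2)" "x $ j - 1/2 \<in> \<int>"
  shows "x \<in> perforated D J"
  unfolding mem_perforated_iff
proof
  fix k :: "real^'n" assume "k \<in> integer_lattice - J"
  then have "k $ j \<in> \<int>" by (auto simp: integer_lattice_def)
  then show "x - k \<notin> closure D"
    using half_integer_not_near[OF _ assms(2), of "k $ j"] assms(1) by (force simp: cube_def)
qed

text \<open>A hole centred at \<open>k\<close> that meets this closed cell forces \<open>k\<close>
  and \<open>m\<close> to differ by less than 1 in every coordinate, hence to agree. As the holes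
  lie in open cubes, the faces of the cell are included and the detour may run along them.\<close>

lemma removed_cell_mem_perforated:
  fixes x :: "real^'n"
  assumes "closure D \<subseteq> cube (1/2)" "m \<in> J" "m \<in> integer_lattice"
    and "\<And>i. \<bar>x $ i - m $ i\<bar> \<le> 1/2"
  shows "x \<in> perforated D J"
  unfolding mem_perforated_iff
proof (intro ballI notI)
  fix k :: "real^'n" assume k: "k \<in> integer_lattice - J" and "x - k \<in> closure D"
  then have "x - k \<in> cube (1/2)" using assms(1) by blast
  have *: "\<bar>x $ i - k $ i\<bar> < 1/2" for i
  proof -
    have "- (1/2) < (x - k) $ i" "(x - k) $ i < 1/2"
      using \<open>x - k \<in> cube (1/2)\<close> unfolding cube_def by blast+
    then show ?thesis unfolding vector_minus_component by linarith
  qed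
  have "k $ i = m $ i" for i
  proof -
    have "k $ i - m $ i \<in> \<int>" using k assms(3) by (auto simp: integer_lattice_def)
    moreover have "\<bar>k $ i - m $ i\<bar> < 1" using *[of i] assms(4)[of i] by linarith
    ultimately show ?thesis using Ints_nonzero_abs_less1[of "k $ i - m $ i"] by simp
  qed
  then have "k = m" by (simp add: vec_eq_iff)
  then show False using k assms(2) by simp
qed

text \<open>At a minimum point of the periodic corrector a constant is an admissible test function,
  even on the boundary, because the supersolution property holds on the closure.\<close>

lemma cell_problem_upper:
  fixes a :: "real^'n \<Rightarrow> real"
  assumes cell: "cell_problem_solvable (quadratic_hamiltonian a) (perforated D {}) p c"
    and D: "closure D \<subseteq> cube (1/2)"
    and a: "\<And>y. y \<in> closure (perforated D {}) \<Longrightarrow> a y = 1"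
  shows "c \<le> (norm p)\<^sup>2 / 2"
proof -
  let ?C = "closure (perforated D {})"
  obtain v where cont: "continuous_on ?C v"
    and per: "\<And>m y. m \<in> integer_lattice \<Longrightarrow> y \<in> ?C \<Longrightarrow> v (y + m) = v y"
    and super: "viscosity_supersolution (\<lambda>y q. quadratic_hamiltonian a y (p + q) - c) ?C v"
    using cell by (auto simp: cell_problem_solvable_def)
  let ?K = "?C \<inter> cbox 0 1"
  have "(\<chi> i. 1/2) \<in> perforated D {}"
    by (rule half_integer_mem_perforated[OF D]) auto
  then have "(\<chi> i. 1/2) \<in> ?K"
    using closure_subset[of "perforated D {}"] by (auto simp: mem_box_cart)
  moreover have "compact ?K" by (intro closed_Int_compact) auto
  ultimately obtain y where y: "y \<in> ?K" "\<And>x. x \<in> ?K \<Longrightarrow> v y \<le> v x"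
    using continuous_attains_inf[of ?K v] continuous_on_subset[OF cont] by blast
  have "v y \<le> v x" if x: "x \<in> ?C" for x
  proof -
    \<comment> \<open>Subtracting integer parts moves \<open>x\<close> into the unit cube, so the
      minimum over \<open>?K\<close> is global.\<close>
    define m :: "real^'n" where "m = (\<chi> i. - of_int \<lfloor>x $ i\<rfloor>)"
    have m: "m \<in> integer_lattice" by (auto simp: m_def integer_lattice_def)
    have "0 \<le> (x + m) $ i \<and> (x + m) $ i \<le> 1" for i
      unfolding m_def vector_add_component vec_lambda_beta
      using of_int_floor_le[of "x $ i"] real_of_int_floor_add_one_ge[of "x $ i"] by linarith
    then have "x + m \<in> cbox 0 1" by (simp add: mem_box_cart)
    then have "x + m \<in> ?K" using closure_perforated_translate[OF m x] by (simp add: add.commute)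
    then show ?thesis using y(2) per[OF m x] by metis
  qed
  then have "\<forall>\<^sub>F x in at y within ?C. v x - 0 \<ge> v y - 0"
    by (auto simp: eventually_at intro: exI[of _ 1])
  moreover have "C1_gradient (\<lambda>x::real^'n. 0) (\<lambda>x. 0)"
    by (intro C1_gradientI GDERIV_const continuous_intros)
  ultimately have "quadratic_hamiltonian a y (p + 0) - c \<ge> 0"
    using super y(1) unfolding viscosity_supersolution_def by blast
  then show ?thesis using a y(1) by (simp add: quadratic_hamiltonian_def)
qed

text \<open>If \<open>c\<close> were smaller, the corrector would strictly decrease over one period
  of a corridor line in direction \<open>i\<close>, contradicting periodicity. The index
  \<open>j\<close> provides the coordinate held at a half-integer.\<close>

lemma cell_problem_lower:
  fixes a :: "real^'n \<Rightarrow> real"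
  assumes cell: "cell_problem_solvable (quadratic_hamiltonian a) (perforated D {}) p c"
    and D: "closure D \<subseteq> cube (1/2)" "bounded D"
    and a: "\<And>y. y \<in> closure (perforated D {}) \<Longrightarrow> a y = 1"
    and ij: "i \<noteq> j"
  shows "(p $ i)\<^sup>2 / 2 \<le> c"
proof (rule ccontr)
  assume "\<not> (p $ i)\<^sup>2 / 2 \<le> c"
  then have c: "2 * c < (p $ i)\<^sup>2" by simp
  let ?\<Omega> = "perforated D {}"
  obtain v where cont: "continuous_on (closure ?\<Omega>) v"
    and per: "\<And>m y. m \<in> integer_lattice \<Longrightarrow> y \<in> closure ?\<Omega> \<Longrightarrow> v (y + m) = v y"
    and sub: "viscosity_subsolution (\<lambda>y q. quadratic_hamiltonian a y (p + q) - c) ?\<Omega> v"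
    using cell by (auto simp: cell_problem_solvable_def)
  define r where "r = sqrt (max 0 (2 * c))"
  \<comment> \<open>The orientation makes \<open>p \<bullet> V\<close> equal to the absolute value
    of \<open>p $ i\<close>.\<close>
  define \<tau> :: real where "\<tau> = (if p $ i \<ge> 0 then 1 else - 1)"
  define V where "V = axis i \<tau>"
  define z :: "real^'n" where "z = axis j (1/2)"
  have pV: "p \<bullet> V = \<bar>p $ i\<bar>" by (auto simp: V_def \<tau>_def inner_axis)
  have VV: "V \<bullet> V = 1" "norm V = 1"
    by (auto simp: V_def \<tau>_def inner_axis norm_eq_1)
  have seg: "z + s *\<^sub>R V \<in> ?\<Omega>" for s
    by (rule half_integer_mem_perforated[OF D(1), where j = j])
      (use ij in \<open>auto simp: z_def V_def axis_def\<close>)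
  \<comment> \<open>For \<open>c < 0\<close> no gradient satisfies the subsolution inequality where
    \<open>a = 1\<close>, so any negative rate serves and \<open>- 1\<close> is a
    placeholder.\<close>
  define b where "b = (if c < 0 then - 1 else r - \<bar>p $ i\<bar>)"
  have "b < 0"
  proof (cases "c < 0")
    case False
    then have "r < \<bar>p $ i\<bar>"
      unfolding r_def using c by (intro real_less_lsqrt) auto
    then show ?thesis using False by (simp add: b_def)
  qed (simp add: b_def)
  have "v (z + 1 *\<^sub>R V) - v z \<le> 1 * b"
  proof (rule subsolution_along_segment_const[OF sub, where \<nu> = V and U = ?\<Omega>])
    show "open ?\<Omega>" using D by (rule_tac open_perforated)
    show "continuous_on {x \<in> ?\<Omega>. 0 \<le> (x - z) \<bullet> V} v"
      by (rule continuous_on_subset[OF cont]) (use closure_subset in blast)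
    fix x q assume x: "x \<in> ?\<Omega>" and "quadratic_hamiltonian a x (p + q) - c \<le> 0"
    then have *: "(norm (p + q))\<^sup>2 \<le> 2 * c"
      using a[of x] closure_subset[of ?\<Omega>] by (auto simp: quadratic_hamiltonian_def)
    then have "c \<ge> 0" using zero_le_power2[of "norm (p + q)"] by linarith
    have "norm (p + q) \<le> r"
      unfolding r_def using * by (intro real_le_rsqrt) auto
    then have "(p + q) \<bullet> V \<le> r"
      using norm_cauchy_schwarz[of "p + q" V] VV by simp
    then show "q \<bullet> V \<le> b" using pV \<open>c \<ge> 0\<close> by (simp add: b_def inner_simps)
  qed (use VV seg in auto)
  moreover have "v (z + V) = v z"
  proof (rule per)
    show "V \<in> integer_lattice" by (auto simp: V_def \<tau>_def integer_lattice_def axis_def)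
    show "z \<in> closure ?\<Omega>" using seg[of 0] closure_subset by auto
  qed
  ultimately show False using \<open>b < 0\<close> by simp
qed

subsection \<open>Evolution problems\<close>

text \<open>The segment estimate in space-time with velocity \<open>(v, 1)\<close>. The covector
  \<open>(0, 1)\<close> measures elapsed time, so only times after \<open>s\<close> count although
  \<open>U \<times> UNIV\<close> contains negative ones.\<close>

lemma cauchy_solution_along_segment:
  assumes w: "cauchy_solution H U g w" and U: "open U"
    and seg: "\<And>\<sigma>. 0 \<le> \<sigma> \<Longrightarrow> \<sigma> \<le> T \<Longrightarrow> x + \<sigma> *\<^sub>R v \<in> U"
    and sT: "0 \<le> s" "0 \<le> T"
    and l: "continuous_on UNIV l"
    and bound: "\<And>y q. y \<in> U \<Longrightarrow> q \<bullet> v - H y q \<le> l y"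
  shows "w (x + T *\<^sub>R v, s + T) - w (x, s) \<le> integral {0..T} (\<lambda>\<sigma>. l (x + \<sigma> *\<^sub>R v))"
proof -
  let ?F = "\<lambda>(x, t) (q, \<tau>). \<tau> + H x q"
  have cont: "continuous_on (closure U \<times> {0..}) w"
    and sub: "viscosity_subsolution ?F (U \<times> {0<..}) w"
    using w by (auto simp: cauchy_solution_def)
  have "w ((x, s) + T *\<^sub>R (v, 1)) - w (x, s) \<le>
      integral {0..T} (\<lambda>\<sigma>. (l \<circ> fst) ((x, s) + \<sigma> *\<^sub>R (v, 1)))"
  proof (rule subsolution_along_segment[OF sub, where \<nu> = "(0, 1)" and U = "U \<times> UNIV"])
    show "open (U \<times> (UNIV :: real set))" using U by (simp add: open_Times)
    have "{p \<in> U \<times> UNIV. 0 \<le> (p - (x, s)) \<bullet> (0, 1)} \<subseteq> closure U \<times> {0..}"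
      using sT closure_subset by (auto simp: inner_Pair_0)
    then show "continuous_on {p \<in> U \<times> UNIV. 0 \<le> (p - (x, s)) \<bullet> (0, 1)} w"
      by (rule continuous_on_subset[OF cont])
    show "continuous_on UNIV (l \<circ> fst)"
      by (intro continuous_on_compose continuous_on_subset[OF l] continuous_intros) auto
    fix p assume "p \<in> U \<times> (UNIV :: real set)"
    then have p: "fst p \<in> U" by auto
    show "p \<in> U \<times> {0<..}" if "0 < (p - (x, s)) \<bullet> (0, 1)"
      using that p sT by (cases p) auto
    fix q assume "?F p q \<le> 0"
    then show "q \<bullet> (v, 1) \<le> (l \<circ> fst) p"
      using bound[OF p, of "fst q"] by (cases p; cases q) auto
  qed (use sT seg in \<open>auto\<close>)
  then show ?thesis by simp
qed

lemma cauchy_solution_along_segment_const: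
  assumes "cauchy_solution H U g w" "open U"
    "\<And>\<sigma>. 0 \<le> \<sigma> \<Longrightarrow> \<sigma> \<le> T \<Longrightarrow> x + \<sigma> *\<^sub>R v \<in> U"
    "0 \<le> s" "0 \<le> T"
    "\<And>y q. y \<in> U \<Longrightarrow> q \<bullet> v - H y q \<le> b"
  shows "w (x + T *\<^sub>R v, s + T) - w (x, s) \<le> T * b"
  using cauchy_solution_along_segment[OF assms(1-5), of "\<lambda>_. b"] assms(5,6) by simp

section \<open>The limit problem with linear initial data\<close>

lemma inner_minus_square_le:
  fixes q v :: "'a::real_inner"
  assumes "h > 0"
  shows "q \<bullet> v - h * (norm q)\<^sup>2 / 2 \<le> (norm v)\<^sup>2 / (2 * h)"
proof -
  have "0 \<le> (norm (h *\<^sub>R q - v))\<^sup>2" by simp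
  also have "\<dots> = h\<^sup>2 * (norm q)\<^sup>2 - 2 * h * (q \<bullet> v) + (norm v)\<^sup>2"
    unfolding power2_norm_eq_inner
    by (simp add: inner_simps inner_commute power2_eq_square algebra_simps)
  finally show ?thesis using assms by (simp add: field_simps power2_eq_square)
qed

lemma affine_comparison_gradient:
  fixes e y :: "'a::euclidean_space"
  defines "d \<equiv> \<lambda>(x, t). x + t *\<^sub>R e - y"
  shows "C1_gradient
     (\<lambda>(x, t). - (x \<bullet> e) - t / 2 - (1 + t) / 20 * (norm (d (x, t)))\<^sup>2 - exp (k * (t - 3/2)))
     (\<lambda>(x, t). (- e - ((1 + t) / 10) *\<^sub>R d (x, t),
        - (1/2) - (norm (d (x, t)))\<^sup>2 / 20 - (1 + t) / 10 * (d (x, t) \<bullet> e) - k * exp (k * (t - 3/2))))"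
proof (rule C1_gradientI)
  show "continuous_on UNIV (\<lambda>(x, t). (- e - ((1 + t) / 10) *\<^sub>R d (x, t),
        - (1/2) - (norm (d (x, t)))\<^sup>2 / 20 - (1 + t) / 10 * (d (x, t) \<bullet> e) - k * exp (k * (t - 3/2))))"
    unfolding d_def case_prod_beta by (intro continuous_intros) auto
next
  fix p :: "'a \<times> real"
  show "GDERIV (\<lambda>(x, t). - (x \<bullet> e) - t / 2 - (1 + t) / 20 * (norm (d (x, t)))\<^sup>2 - exp (k * (t - 3/2))) p :>
     (case p of (x, t) \<Rightarrow> (- e - ((1 + t) / 10) *\<^sub>R d (x, t),
        - (1/2) - (norm (d (x, t)))\<^sup>2 / 20 - (1 + t) / 10 * (d (x, t) \<bullet> e) - k * exp (k * (t - 3/2))))"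
    unfolding gderiv_def power2_norm_eq_inner d_def case_prod_beta
    apply (rule derivative_eq_intros refl | simp)+
    apply (rule ext)
    apply (simp add: inner_prod_def inner_simps field_simps inner_commute power2_norm_eq_inner)
    done
qed

text \<open>
  The barrier \<open>\<phi>\<close> is \<open>- x \<bullet> e - t/2\<close> lowered by a paraboloid moving with velocity \<open>- e\<close>, whose vertex
  passes through \<open>x\<close> at time 1 and whose opening \<open>(1 + t) / 20\<close> grows fast enough for \<open>\<phi>\<close> to be a
  strict subsolution on \<open>[0, 2]\<close>. The exponential term excludes a contact at the artificial final
  time 2.
\<close>
lemma eikonal_linear_data_lower:
  fixes u :: "(real^'n) \<times> real \<Rightarrow> real"
  assumes sol: "cauchy_solution (\<lambda>x. h) UNIV (\<lambda>x. - (x \<bullet> e)) u"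
    and h_le: "\<And>p. h p \<le> (norm p)\<^sup>2 / 2"
    and e: "norm e = 1"
    and growth: "\<And>x t. 0 \<le> t \<Longrightarrow> t \<le> 2 \<Longrightarrow> c - (norm x)\<^sup>2 / 80 \<le> u (x, t)"
  shows "- (x \<bullet> e) - 1/2 \<le> u (x, 1)"
proof -
  have cont: "continuous_on (UNIV \<times> {0..}) u"
    and super: "viscosity_supersolution (\<lambda>(x, t) (q, \<tau>). \<tau> + h q) (UNIV \<times> {0<..}) u"
    and init: "\<And>x. u (x, 0) = - (x \<bullet> e)"
    using sol by (auto simp: cauchy_solution_def)
  define y where "y = x + e"
  define d where "d = (\<lambda>(x, t). x + t *\<^sub>R e - y)"
  \<comment> \<open>\<open>R\<close> bounds the norm of the vertex \<open>y - t *\<^sub>R e\<close>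
    up to time 2, \<open>m\<close> collects the constants of the coercivity estimate, and
    \<open>\<rho>\<close> is so large that \<open>m - D + D\<^sup>2 / 40\<close> is nonnegative for
    \<open>D \<ge> \<rho>\<close>.\<close>
  define R where "R = norm y + 2"
  define m where "m = c - R\<^sup>2 / 40 - R"
  define \<rho> where "\<rho> = 40 * (1 + \<bar>m\<bar>)"
  define K where "K = cball (0 :: real^'n) (\<rho> + R) \<times> {0..2::real}"
  have "R \<ge> 2" by (simp add: R_def)
  have "\<rho> \<ge> 40" by (simp add: \<rho>_def)
  have K: "compact K" "K \<noteq> {}"
    using \<open>R \<ge> 2\<close> \<open>\<rho> \<ge> 40\<close> by (auto simp: K_def intro!: compact_Times)
  define \<psi> where "\<psi> = (\<lambda>(x, t). - (x \<bullet> e) - t / 2 - (1 + t) / 20 * (norm (d (x, t)))\<^sup>2)"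
  \<comment> \<open>Up to constants the growth condition loses at most
    \<open>D\<^sup>2 / 40\<close>, half of what the paraboloid yields; the other half
    remains.\<close>
  have coercive: "m - norm (d (\<xi>, t)) + (norm (d (\<xi>, t)))\<^sup>2 / 40 \<le> u (\<xi>, t) - \<psi> (\<xi>, t)"
    and d_large: "norm \<xi> - R \<le> norm (d (\<xi>, t))"
    if t: "0 \<le> t" "t \<le> 2" for \<xi> t
  proof -
    define D where "D = norm (d (\<xi>, t))"
    have "norm (y - t *\<^sub>R e) \<le> R"
      using norm_triangle_ineq4[of y "t *\<^sub>R e"] t e by (simp add: R_def)
    moreover have "\<xi> = d (\<xi>, t) + (y - t *\<^sub>R e)" by (simp add: d_def)
    ultimately have \<xi>: "norm \<xi> \<le> D + R"
      unfolding D_def by (metis norm_triangle_le add_left_mono)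
    then show "norm \<xi> - R \<le> norm (d (\<xi>, t))" by (simp add: D_def)
    have "(norm \<xi>)\<^sup>2 \<le> (D + R)\<^sup>2" using \<xi> by (intro power_mono) auto
    also have "\<dots> \<le> 2 * D\<^sup>2 + 2 * R\<^sup>2"
      using zero_le_power2[of "D - R"] by (simp add: power2_eq_square algebra_simps)
    finally have sq: "(norm \<xi>)\<^sup>2 / 80 \<le> D\<^sup>2 / 40 + R\<^sup>2 / 40" by simp
    have "- (\<xi> \<bullet> e) \<le> norm \<xi>"
      using norm_cauchy_schwarz[of "- \<xi>" e] e by simp
    then have "- (\<xi> \<bullet> e) \<le> D + R" using \<xi> by simp
    moreover have "D\<^sup>2 / 20 \<le> (1 + t) / 20 * D\<^sup>2"
      using mult_right_mono[of 1 "1 + t" "D\<^sup>2"] t by simp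
    ultimately show "m - norm (d (\<xi>, t)) + (norm (d (\<xi>, t)))\<^sup>2 / 40 \<le> u (\<xi>, t) - \<psi> (\<xi>, t)"
      using growth[OF t, of \<xi>] sq t unfolding \<psi>_def prod.case D_def[symmetric] m_def by linarith
  qed
  have below: "m - 10 \<le> u (\<xi>, t) - \<psi> (\<xi>, t)" if "0 \<le> t" "t \<le> 2" for \<xi> t
    using coercive[OF that, of \<xi>] zero_le_power2[of "norm (d (\<xi>, t)) - 20"]
    by (simp add: power2_eq_square algebra_simps)
  have outside: "0 \<le> u (\<xi>, t) - \<psi> (\<xi>, t)" if t: "0 \<le> t" "t \<le> 2" and \<xi>: "norm \<xi> \<ge> \<rho> + R" for \<xi> t
  proof -
    define D where "D = norm (d (\<xi>, t))"
    have D: "D \<ge> \<rho>" using d_large[OF t, of \<xi>] \<xi> by (simp add: D_def)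
    then have "D / 40 - 1 \<ge> \<bar>m\<bar>" "D \<ge> 1" using \<open>\<rho> \<ge> 40\<close> by (simp_all add: \<rho>_def)
    then have "1 * \<bar>m\<bar> \<le> D * (D / 40 - 1)" by (intro mult_mono) auto
    then have "0 \<le> m - D + D\<^sup>2 / 40"
      by (simp add: power2_eq_square algebra_simps abs_if split: if_splits)
    then show ?thesis using coercive[OF t, of \<xi>] by (simp add: D_def)
  qed
  have "- (x \<bullet> e) - 1/2 \<le> u (x, 1) + \<eta>" if "\<eta> > 0" for \<eta>
  proof -
    \<comment> \<open>The bound \<open>\<bar>m\<bar> + 10\<close> lets the exponential beat the
      lower bound \<open>m - 10\<close> at time 2, and \<open>1 / \<eta>\<close> makes its value at
      time 1 at most \<open>\<eta>\<close>.\<close>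
    define N where "N = max (1 / \<eta>) (\<bar>m\<bar> + 10)"
    have N: "N \<ge> 1 / \<eta>" "N \<ge> \<bar>m\<bar> + 10" by (simp_all add: N_def)
    then have "N > 1" by linarith
    have "1 / N \<le> \<eta>" using N(1) \<open>N > 1\<close> \<open>\<eta> > 0\<close> by (simp add: field_simps)
    define k where "k = 2 * ln N"
    have k: "k > 0" "exp (k * (2 - 3/2)) = N" "exp (k * (1 - 3/2)) = 1 / N"
      using \<open>N > 1\<close> by (simp_all add: k_def exp_minus inverse_eq_divide)
    define \<phi> where "\<phi> = (\<lambda>(x, t). - (x \<bullet> e) - t / 2 - (1 + t) / 20 * (norm (d (x, t)))\<^sup>2 - exp (k * (t - 3/2)))"
    define G where "G = (\<lambda>(x, t). (- e - ((1 + t) / 10) *\<^sub>R d (x, t),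
        - (1/2) - (norm (d (x, t)))\<^sup>2 / 20 - (1 + t) / 10 * (d (x, t) \<bullet> e) - k * exp (k * (t - 3/2))))"
    have grad: "C1_gradient \<phi> G"
      unfolding \<phi>_def G_def d_def by (rule affine_comparison_gradient)
    have \<phi>\<psi>: "\<phi> (\<xi>, t) = \<psi> (\<xi>, t) - exp (k * (t - 3/2))" for \<xi> t
      by (simp add: \<phi>_def \<psi>_def)
    have "continuous_on K (\<lambda>p. u p - \<phi> p)"
    proof (intro continuous_intros)
      show "continuous_on K u" by (rule continuous_on_subset[OF cont]) (auto simp: K_def)
      show "continuous_on K \<phi>"
        unfolding \<phi>_def d_def case_prod_beta by (intro continuous_intros) auto
    qed
    then obtain \<xi> t where z: "(\<xi>, t) \<in> K" "\<And>p. p \<in> K \<Longrightarrow> u (\<xi>, t) - \<phi> (\<xi>, t) \<le> u p - \<phi> p"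
      using continuous_attains_inf[OF K, of "\<lambda>p. u p - \<phi> p"] by (metis old.prod.exhaust)
    \<comment> \<open>A negative value forces a negative minimum over \<open>K\<close>. Far away and
      at times 0 and 2 the difference is nonnegative, so the contact is interior and the
      supersolution inequality applies.\<close>
    have "0 \<le> u (x, 1) - \<phi> (x, 1)"
    proof (rule ccontr)
      assume neg: "\<not> 0 \<le> u (x, 1) - \<phi> (x, 1)"
      have "norm x < \<rho> + R"
      proof (rule ccontr)
        assume "\<not> ?thesis"
        then have "0 \<le> u (x, 1) - \<psi> (x, 1)" by (intro outside) auto
        then show False using neg exp_ge_zero[of "k * (1 - 3/2)"] unfolding \<phi>\<psi> by linarith
      qed
      then have "(x, 1) \<in> K" by (simp add: K_def)
      then have neg': "u (\<xi>, t) - \<phi> (\<xi>, t) < 0" using z(2) neg by fastforce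
      have t: "0 \<le> t" "t \<le> 2" using z(1) by (auto simp: K_def)
      have \<xi>: "norm \<xi> < \<rho> + R"
      proof (rule ccontr)
        assume "\<not> ?thesis"
        then have "0 \<le> u (\<xi>, t) - \<psi> (\<xi>, t)" by (intro outside t) auto
        then show False using neg' exp_ge_zero[of "k * (t - 3/2)"] unfolding \<phi>\<psi> by linarith
      qed
      have "t \<noteq> 2"
      proof
        assume "t = 2"
        then show False using below[OF t, of \<xi>] neg' N(2) k(2) unfolding \<phi>\<psi> by simp
      qed
      have "t \<noteq> 0"
      proof
        assume "t = 0"
        then have "u (\<xi>, t) - \<phi> (\<xi>, t) = (norm (d (\<xi>, 0)))\<^sup>2 / 20 + exp (k * (0 - 3/2))"
          by (simp add: init \<phi>_def)
        then show False using neg' exp_gt_zero[of "k * (0 - 3/2)"] by (smt (verit) zero_le_power2 divide_nonneg_pos)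
      qed
      then have t': "0 < t" "t < 2" using t \<open>t \<noteq> 2\<close> by auto
      have "open (ball (0::real^'n) (\<rho> + R) \<times> {0<..<2::real})" by (intro open_Times) auto
      moreover have "(\<xi>, t) \<in> ball 0 (\<rho> + R) \<times> {0<..<2}" using \<xi> t' by simp
      moreover have "ball 0 (\<rho> + R) \<times> {0<..<2} \<subseteq> K" by (auto simp: K_def)
      ultimately have "\<forall>\<^sub>F p in at (\<xi>, t) within UNIV \<times> {0<..}. u p - \<phi> p \<ge> u (\<xi>, t) - \<phi> (\<xi>, t)"
        unfolding eventually_at_topological using z(2) by blast
      moreover have "(\<xi>, t) \<in> UNIV \<times> {0<..}" using t' by simp
      ultimately have "0 \<le> (case (\<xi>, t) of (x, t) \<Rightarrow> \<lambda>(q, \<tau>). \<tau> + h q) (G (\<xi>, t))"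
        using super grad unfolding viscosity_supersolution_def by blast
      then have "0 \<le> snd (G (\<xi>, t)) + h (fst (G (\<xi>, t)))" by (simp add: case_prod_beta)
      also have "\<dots> \<le> snd (G (\<xi>, t)) + (norm (fst (G (\<xi>, t))))\<^sup>2 / 2" using h_le by simp
      \<comment> \<open>The constants and the terms with \<open>D \<bullet> e\<close> cancel. What
        remains is \<open>(A\<^sup>2 - 1/10) * (norm D)\<^sup>2 / 2\<close> minus the derivative of
        the exponential, and \<open>A \<le> 3/10\<close>.\<close>
      also have "\<dots> < 0"
      proof -
        define D where "D = d (\<xi>, t)"
        define A where "A = (1 + t) / 10"
        have ee: "e \<bullet> e = 1" using e by (simp add: norm_eq_1)
        have "(norm (- e - A *\<^sub>R D))\<^sup>2 = 1 + 2 * A * (D \<bullet> e) + A\<^sup>2 * (norm D)\<^sup>2"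
          unfolding power2_norm_eq_inner
          by (simp add: inner_simps inner_commute ee power2_eq_square algebra_simps)
        moreover have "A\<^sup>2 * (norm D)\<^sup>2 \<le> 1/10 * (norm D)\<^sup>2"
        proof (rule mult_right_mono)
          have "A\<^sup>2 \<le> (3/10)\<^sup>2" using t by (intro power_mono) (auto simp: A_def)
          then show "A\<^sup>2 \<le> 1/10" by (simp add: power2_eq_square)
        qed simp
        moreover have "0 < k * exp (k * (t - 3/2))" using k by simp
        ultimately show ?thesis
          unfolding G_def prod.case fst_conv snd_conv D_def[symmetric] A_def[symmetric] by linarith
      qed
      finally show False by simp
    qed
    moreover have "\<phi> (x, 1) = - (x \<bullet> e) - 1/2 - 1 / N"
      using k(3) by (simp add: \<phi>_def d_def y_def)
    ultimately show ?thesis using \<open>1 / N \<le> \<eta>\<close> by linarith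
  qed
  then show ?thesis by (meson field_le_epsilon)
qed

text \<open>The upper bound follows the segment from \<open>(x + e, 0)\<close> with velocity
  \<open>- e\<close>; the lower bound is the barrier argument, with growth supplied by coercivity.
  The two bounds on \<open>h\<close> agree at multiples of \<open>e\<close>, which fixes the value
  for data of slope \<open>- e\<close>.\<close>

lemma eikonal_linear_data_value:
  fixes u :: "(real^'n) \<times> real \<Rightarrow> real"
  assumes sol: "cauchy_solution (\<lambda>x. h) UNIV (\<lambda>x. - (x \<bullet> e)) u"
    and h_le: "\<And>p. h p \<le> (norm p)\<^sup>2 / 2"
    and h_ge: "\<And>p. (p \<bullet> e)\<^sup>2 / 2 \<le> h p"
    and coercive: "\<And>p. b * (norm p)\<^sup>2 / 2 \<le> h p" "b > 0"
    and e: "norm e = 1"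
  shows "u (x, 1) = - (x \<bullet> e) - 1/2"
proof (rule antisym)
  have "u ((x + e) + 1 *\<^sub>R (- e), 0 + 1) - u (x + e, 0) \<le> 1 * (1/2)"
  proof (rule cauchy_solution_along_segment_const[OF sol])
    fix q
    have "q \<bullet> - e - (q \<bullet> e)\<^sup>2 / 2 \<le> 1/2"
      using zero_le_power2[of "q \<bullet> e + 1"] by (simp add: power2_eq_square algebra_simps)
    then show "q \<bullet> - e - h q \<le> 1/2" using h_ge[of q] by linarith
  qed auto
  moreover have "u (x + e, 0) = - (x \<bullet> e) - 1"
    using sol e by (simp add: cauchy_solution_def inner_simps norm_eq_1)
  ultimately show "u (x, 1) \<le> - (x \<bullet> e) - 1/2" by simp
next
  \<comment> \<open>The segment from \<open>(y, s)\<close> to \<open>(0, T)\<close> costs at most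
    \<open>(norm y)\<^sup>2 / (2 * b * r)\<close>. For \<open>s \<le> 2\<close> the remaining time
    \<open>r\<close> is at least \<open>40 / b\<close>, which gives the factor \<open>1/80\<close>
    that the barrier tolerates.\<close>
  define T where "T = 40 / b + 2"
  have "u (0, T) - (norm y)\<^sup>2 / 80 \<le> u (y, s)" if s: "0 \<le> s" "s \<le> 2" for y s
  proof -
    define r where "r = T - s"
    have "40 / b > 0" using \<open>b > 0\<close> by simp
    then have r: "r \<ge> 40 / b" "r > 0" using s unfolding r_def T_def by linarith+
    define v where "v = - (1 / r) *\<^sub>R y"
    have "u (y + r *\<^sub>R v, s + r) - u (y, s) \<le> r * ((norm v)\<^sup>2 / (2 * b))"
    proof (rule cauchy_solution_along_segment_const[OF sol])
      show "q \<bullet> v - h q \<le> (norm v)\<^sup>2 / (2 * b)" for q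
        using inner_minus_square_le[OF \<open>b > 0\<close>, of q v] coercive(1)[of q] by linarith
    qed (use s r in auto)
    moreover have "y + r *\<^sub>R v = 0" "s + r = T" using r by (auto simp: v_def r_def)
    moreover have "r * ((norm v)\<^sup>2 / (2 * b)) = (norm y)\<^sup>2 / (2 * b * r)"
      using r by (simp add: v_def power2_eq_square field_simps)
    moreover have "(norm y)\<^sup>2 / (2 * b * r) \<le> (norm y)\<^sup>2 / 80"
      using r \<open>b > 0\<close> by (intro divide_left_mono) (auto simp: field_simps)
    ultimately show ?thesis by simp
  qed
  then show "- (x \<bullet> e) - 1/2 \<le> u (x, 1)"
    by (rule eikonal_linear_data_lower[OF sol h_le e])
qed

subsection \<open>The detour path\<close>

text \<open>Space and time scale alike, so a path drawn in cell coordinates keeps its velocity while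
  duration and cost are multiplied by \<open>\<epsilon>\<close>.\<close>

lemma scaled_solution_along_segment:
  fixes a :: "real^'n \<Rightarrow> real"
  assumes w: "cauchy_solution (\<lambda>x p. quadratic_hamiltonian a (x /\<^sub>R \<epsilon>) p) ((\<lambda>y. \<epsilon> *\<^sub>R y) ` W) g w"
    and "\<epsilon> > 0" "open W" and a: "continuous_on UNIV a" "\<And>y. a y > 0"
    and seg: "\<And>\<sigma>. 0 \<le> \<sigma> \<Longrightarrow> \<sigma> \<le> \<tau> \<Longrightarrow> y + \<sigma> *\<^sub>R v \<in> W"
    and s: "0 \<le> s" "0 \<le> \<tau>"
  shows "w (\<epsilon> *\<^sub>R (y + \<tau> *\<^sub>R v), s + \<epsilon> * \<tau>)
    \<le> w (\<epsilon> *\<^sub>R y, s) + \<epsilon> * integral {0..\<tau>} (\<lambda>\<sigma>. (norm v)\<^sup>2 / (2 * a (y + \<sigma> *\<^sub>R v)))"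
proof -
  let ?l = "\<lambda>x. (norm v)\<^sup>2 / (2 * a (x /\<^sub>R \<epsilon>))"
  let ?f = "\<lambda>\<sigma>. (norm v)\<^sup>2 / (2 * a (y + \<sigma> *\<^sub>R v))"
  have ne: "a y \<noteq> 0" for y using a(2)[of y] by simp
  have "w (\<epsilon> *\<^sub>R y + (\<epsilon> * \<tau>) *\<^sub>R v, s + \<epsilon> * \<tau>) - w (\<epsilon> *\<^sub>R y, s)
      \<le> integral {0..\<epsilon> * \<tau>} (\<lambda>\<sigma>. ?l (\<epsilon> *\<^sub>R y + \<sigma> *\<^sub>R v))"
  proof (rule cauchy_solution_along_segment[OF w])
    show "open ((\<lambda>y. \<epsilon> *\<^sub>R y) ` W)" using \<open>\<epsilon> > 0\<close> \<open>open W\<close> by (simp add: open_scaling)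
    show "\<epsilon> *\<^sub>R y + \<sigma> *\<^sub>R v \<in> (\<lambda>y. \<epsilon> *\<^sub>R y) ` W" if "0 \<le> \<sigma>" "\<sigma> \<le> \<epsilon> * \<tau>" for \<sigma>
    proof (rule image_eqI)
      show "\<epsilon> *\<^sub>R y + \<sigma> *\<^sub>R v = \<epsilon> *\<^sub>R (y + (\<sigma> / \<epsilon>) *\<^sub>R v)"
        using \<open>\<epsilon> > 0\<close> by (simp add: scaleR_add_right)
      show "y + (\<sigma> / \<epsilon>) *\<^sub>R v \<in> W"
        using seg[of "\<sigma> / \<epsilon>"] that \<open>\<epsilon> > 0\<close> by (simp add: field_simps)
    qed
    show "continuous_on UNIV ?l"
      by (intro continuous_intros continuous_on_compose2[OF a(1)]) (use ne in auto)
    show "q \<bullet> v - quadratic_hamiltonian a (x /\<^sub>R \<epsilon>) q \<le> ?l x" for x q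
      unfolding quadratic_hamiltonian_def by (rule inner_minus_square_le) (rule a(2))
  qed (use s \<open>\<epsilon> > 0\<close> in auto)
  also have "integral {0..\<epsilon> * \<tau>} (\<lambda>\<sigma>. ?l (\<epsilon> *\<^sub>R y + \<sigma> *\<^sub>R v)) = \<epsilon> * integral {0..\<tau>} ?f"
  proof (rule integral_unique)
    have "continuous_on {0..\<tau>} ?f"
      by (intro continuous_intros continuous_on_compose2[OF a(1)]) (use ne in auto)
    then have "(?f has_integral integral {0..\<tau>} ?f) {0..\<tau>}"
      by (intro integrable_integral integrable_continuous_real)
    from has_integral_stretch_real[OF this, of "1 / \<epsilon>"]
    have "((\<lambda>\<sigma>. ?f (\<sigma> / \<epsilon>)) has_integral \<epsilon> * integral {0..\<tau>} ?f) ((\<lambda>x. x * \<epsilon>) ` {0..\<tau>})"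
      using \<open>\<epsilon> > 0\<close> by simp
    moreover have "(\<lambda>x. x * \<epsilon>) ` {0..\<tau>} = {0..\<epsilon> * \<tau>}"
      using \<open>\<epsilon> > 0\<close> s image_mult_atLeastAtMost[of \<epsilon> 0 \<tau>] by (simp add: mult.commute[of _ \<epsilon>])
    moreover have "(\<epsilon> *\<^sub>R y + \<sigma> *\<^sub>R v) /\<^sub>R \<epsilon> = y + (\<sigma> / \<epsilon>) *\<^sub>R v" for \<sigma>
      using \<open>\<epsilon> > 0\<close> by (simp add: scaleR_add_right divide_inverse_commute)
    ultimately show "((\<lambda>\<sigma>. ?l (\<epsilon> *\<^sub>R y + \<sigma> *\<^sub>R v)) has_integral \<epsilon> * integral {0..\<tau>} ?f) {0..\<epsilon> * \<tau>}"
      by (simp only:)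
  qed
  finally show ?thesis by (simp add: scaleR_add_right)
qed

lemma scaled_solution_along_segment_const:
  fixes a :: "real^'n \<Rightarrow> real"
  assumes w: "cauchy_solution (\<lambda>x p. quadratic_hamiltonian a (x /\<^sub>R \<epsilon>) p) ((\<lambda>y. \<epsilon> *\<^sub>R y) ` W) g w"
    and "\<epsilon> > 0" "open W" and a: "continuous_on UNIV a" "\<And>y. a y \<ge> 1"
    and seg: "\<And>\<sigma>. 0 \<le> \<sigma> \<Longrightarrow> \<sigma> \<le> \<tau> \<Longrightarrow> y + \<sigma> *\<^sub>R v \<in> W"
    and s: "0 \<le> s" "0 \<le> \<tau>"
  shows "w (\<epsilon> *\<^sub>R (y + \<tau> *\<^sub>R v), s + \<epsilon> * \<tau>) \<le> w (\<epsilon> *\<^sub>R y, s) + \<epsilon> * (\<tau> * (norm v)\<^sup>2 / 2)"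
proof -
  have pos: "a y > 0" for y using a(2)[of y] by linarith
  have ne: "a y \<noteq> 0" for y using pos[of y] by simp
  let ?f = "\<lambda>\<sigma>. (norm v)\<^sup>2 / (2 * a (y + \<sigma> *\<^sub>R v))"
  have "continuous_on {0..\<tau>} ?f"
    by (intro continuous_intros continuous_on_compose2[OF a(1)]) (use ne in auto)
  then have "integral {0..\<tau>} ?f \<le> integral {0..\<tau>} (\<lambda>\<sigma>. (norm v)\<^sup>2 / 2)"
  proof (intro integral_le integrable_continuous_real)
    show "?f \<sigma> \<le> (norm v)\<^sup>2 / 2" for \<sigma>
      using a(2)[of "y + \<sigma> *\<^sub>R v"] pos[of "y + \<sigma> *\<^sub>R v"] by (intro divide_left_mono) auto
  qed auto
  also have "\<dots> = \<tau> * (norm v)\<^sup>2 / 2" using s by simp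
  finally have "\<epsilon> * integral {0..\<tau>} ?f \<le> \<epsilon> * (\<tau> * (norm v)\<^sup>2 / 2)"
    using \<open>\<epsilon> > 0\<close> by simp
  with scaled_solution_along_segment[OF w assms(2,3) a(1) pos seg s] show ?thesis by simp
qed

text \<open>At speed 2 the Lagrangian is \<open>2 / a\<close>; the substitution
  \<open>s = 1/2 - 2 * \<sigma>\<close> absorbs the factor 2, and periodicity removes the cell
  position \<open>m\<close>.\<close>

lemma detour_integral:
  fixes a :: "real^'n \<Rightarrow> real"
  assumes per: "\<forall>m\<in>integer_lattice. \<forall>y. a (y + m) = a y" and a: "continuous_on UNIV a" "\<And>y. a y > 0"
    and m: "m \<in> integer_lattice"
  shows "integral {0..1/2} (\<lambda>\<sigma>. (norm (- 2 *\<^sub>R axis i 1 :: real^'n))\<^sup>2 / (2 * a (m + (1/2) *\<^sub>R axis i 1 + p + \<sigma> *\<^sub>R (- 2 *\<^sub>R axis i 1))))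
    = integral {-1/2..1/2} (\<lambda>s. 1 / a (p + s *\<^sub>R axis i 1))"
proof (rule integral_unique)
  let ?f = "\<lambda>s. 1 / a (p + s *\<^sub>R axis i 1)"
  have "continuous_on {-1/2..1/2} ?f"
    by (intro continuous_intros continuous_on_compose2[OF a(1)]) (use a(2) in \<open>auto simp: less_imp_neq[THEN not_sym]\<close>)
  then have "(?f has_integral integral {-1/2..1/2} ?f) (cbox (-1/2) (1/2))"
    by (simp add: integrable_integral integrable_continuous_real)
  from has_integral_affinity[OF this, of "-2" "1/2"]
  have "((\<lambda>x. ?f (- 2 * x + 1/2)) has_integral integral {-1/2..1/2} ?f / 2)
      ((\<lambda>x. - (1/2) * x + 1/4) ` {-1/2..1/2})" by simp
  moreover have "(\<lambda>x::real. - (1/2) * x + 1/4) ` {-1/2..1/2} = {0..1/2}"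
    by (subst image_affinity_atLeastAtMost) simp
  ultimately have "((\<lambda>x. 2 * ?f (- 2 * x + 1/2)) has_integral 2 * (integral {-1/2..1/2} ?f / 2)) {0..1/2}"
    by (intro has_integral_mult_right) simp
  moreover have "2 * ?f (- 2 * \<sigma> + 1/2) = (norm (- 2 *\<^sub>R axis i 1 :: real^'n))\<^sup>2
      / (2 * a (m + (1/2) *\<^sub>R axis i 1 + p + \<sigma> *\<^sub>R (- 2 *\<^sub>R axis i 1)))" for \<sigma>
  proof -
    have "(norm (- 2 *\<^sub>R axis i 1 :: real^'n))\<^sup>2 = 4"
      by (simp add: power2_norm_eq_inner inner_axis)
    moreover have "m + (1/2) *\<^sub>R axis i 1 + p + \<sigma> *\<^sub>R (- 2 *\<^sub>R axis i 1) = (p + (- 2 * \<sigma> + 1/2) *\<^sub>R axis i 1) + m"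
      by (simp add: algebra_simps)
    then have "a (m + (1/2) *\<^sub>R axis i 1 + p + \<sigma> *\<^sub>R (- 2 *\<^sub>R axis i 1)) = a (p + (- 2 * \<sigma> + 1/2) *\<^sub>R axis i 1)"
      using per m by (simp only:)
    ultimately show ?thesis by (simp only:)
  qed
  ultimately show "((\<lambda>\<sigma>. (norm (- 2 *\<^sub>R axis i 1 :: real^'n))\<^sup>2
      / (2 * a (m + (1/2) *\<^sub>R axis i 1 + p + \<sigma> *\<^sub>R (- 2 *\<^sub>R axis i 1)))) has_integral integral {-1/2..1/2} ?f) {0..1/2}"
    by simp
qed

text \<open>Forwards in time the path runs towards decreasing first coordinate, starting at 1. Each
  of the \<open>N\<close> detours saves \<open>\<epsilon> * (1/4 - A)\<close> against the total
  corridor cost 1/2. The condition on \<open>N\<close> makes all these cells fit into the available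
  length.\<close>

lemma detour_path_upper_bound:
  fixes a :: "real^'n \<Rightarrow> real" and i j :: 'n
  defines "e1 \<equiv> axis i 1" and "e2 \<equiv> axis j 1"
  defines "A \<equiv> integral {-1/2..1/2} (\<lambda>s. 1 / a ((1/4) *\<^sub>R e2 + s *\<^sub>R e1))"
  assumes ij: "i \<noteq> j"
    and w: "cauchy_solution (\<lambda>x p. quadratic_hamiltonian a (x /\<^sub>R \<epsilon>) p)
      ((\<lambda>y. \<epsilon> *\<^sub>R y) ` perforated D (square_cells e1)) (\<lambda>x. - (x \<bullet> e1)) w"
    and D: "closure D \<subseteq> cube (1/2)" "bounded D"
    and a: "continuous_on UNIV a" "\<And>y. a y \<ge> 1"
    and per: "\<forall>m\<in>integer_lattice. \<forall>y. a (y + m) = a y"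
    and \<epsilon>: "\<epsilon> > 0" "\<epsilon> * ((real N)\<^sup>2 + 1/2) \<le> 1"
  shows "w ((\<epsilon> / 2) *\<^sub>R e2, 1) \<le> - 1/2 - \<epsilon> * real N * (1/4 - A)"
proof -
  let ?W = "perforated D (square_cells e1)"
  have pos: "a y > 0" for y using a(2)[of y] by linarith
  have W: "open ?W" using D by (rule_tac open_perforated)
  have comp: "e1 $ i = 1" "e1 $ j = 0" "e2 $ j = 1" "e2 $ i = 0" "norm e1 = 1" "norm e2 = 1"
    "e1 \<bullet> e1 = 1" "e2 \<bullet> e1 = 0"
    and comp_other: "k \<noteq> i \<Longrightarrow> e1 $ k = 0" "k \<noteq> j \<Longrightarrow> e2 $ k = 0" for k
    using ij by (simp_all add: e1_def e2_def inner_axis) (simp_all add: axis_def)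
  note along = scaled_solution_along_segment_const[OF w \<epsilon>(1) W a]
  \<comment> \<open>The value at the corridor point of abscissa \<open>x\<close> in cell units, at
    the arrival time of a unit-speed path from abscissa \<open>1 / \<epsilon>\<close>. Thus
    \<open>f 0\<close> is the target and \<open>f (1 / \<epsilon>)\<close> an initial value.\<close>
  define f where "f x = w (\<epsilon> *\<^sub>R (x *\<^sub>R e1 + (1/2) *\<^sub>R e2), 1 - \<epsilon> * x)" for x
  have corridor: "f x \<le> f x' + \<epsilon> * ((x' - x) / 2)" if "x \<le> x'" "\<epsilon> * x' \<le> 1" for x x'
  proof -
    have "w (\<epsilon> *\<^sub>R (x' *\<^sub>R e1 + (1/2) *\<^sub>R e2 + (x' - x) *\<^sub>R (- e1)), (1 - \<epsilon> * x') + \<epsilon> * (x' - x))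
        \<le> w (\<epsilon> *\<^sub>R (x' *\<^sub>R e1 + (1/2) *\<^sub>R e2), 1 - \<epsilon> * x') + \<epsilon> * ((x' - x) * (norm (- e1))\<^sup>2 / 2)"
      by (rule along, rule half_integer_mem_perforated[OF D(1), where j = j])
        (use that comp in auto)
    then show ?thesis by (simp add: f_def comp algebra_simps)
  qed
  have detour: "f ((real m)\<^sup>2 - 1/2) \<le> f ((real m)\<^sup>2 + 1/2) + \<epsilon> * (1/4 + A)"
    if m: "m \<ge> 1" "\<epsilon> * ((real m)\<^sup>2 + 1/2) \<le> 1" for m
  proof -
    define c where "c = (real m)\<^sup>2 *\<^sub>R e1"
    have cJ: "c \<in> square_cells e1" using m(1) by (auto simp: c_def square_cells_def)
    have cL: "c \<in> integer_lattice" by (auto simp: c_def e1_def integer_lattice_def axis_def)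
    \<comment> \<open>Corners of the detour: down in time 1/4, across in time 1/2, up in time 1/4.
      In units of \<open>\<epsilon>\<close> the vertical legs cost 1/8 each and the crossing costs
      \<open>A\<close>.\<close>
    define y0 where "y0 = c + (1/2) *\<^sub>R e1 + (1/2) *\<^sub>R e2"
    define y1 where "y1 = c + (1/2) *\<^sub>R e1 + (1/4) *\<^sub>R e2"
    define y2 where "y2 = c - (1/2) *\<^sub>R e1 + (1/4) *\<^sub>R e2"
    define y3 where "y3 = c - (1/2) *\<^sub>R e1 + (1/2) *\<^sub>R e2"
    define t0 where "t0 = 1 - \<epsilon> * ((real m)\<^sup>2 + 1/2)"
    have y: "y0 + (1/4) *\<^sub>R (- e2) = y1" "y1 + (1/2) *\<^sub>R (- 2 *\<^sub>R e1) = y2" "y2 + (1/4) *\<^sub>R e2 = y3"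
      by (simp_all add: y0_def y1_def y2_def y3_def vec_eq_iff)
    have "t0 \<ge> 0" using m by (simp add: t0_def)
    have inW: "c + \<alpha> *\<^sub>R e1 + \<beta> *\<^sub>R e2 \<in> ?W" if "\<bar>\<alpha>\<bar> \<le> 1/2" "\<bar>\<beta>\<bar> \<le> 1/2" for \<alpha> \<beta>
    proof (rule removed_cell_mem_perforated[OF D(1) cJ cL])
      show "\<bar>(c + \<alpha> *\<^sub>R e1 + \<beta> *\<^sub>R e2) $ k - c $ k\<bar> \<le> 1/2" for k
        using that ij comp comp_other[of k] by (cases "k = i"; cases "k = j") auto
    qed
    have "w (\<epsilon> *\<^sub>R (y0 + (1/4) *\<^sub>R (- e2)), t0 + \<epsilon> * (1/4))
        \<le> w (\<epsilon> *\<^sub>R y0, t0) + \<epsilon> * (1/4 * (norm (- e2))\<^sup>2 / 2)"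
    proof (rule along)
      show "y0 + \<sigma> *\<^sub>R - e2 \<in> ?W" if "0 \<le> \<sigma>" "\<sigma> \<le> 1/4" for \<sigma>
        using inW[of "1/2" "1/2 - \<sigma>"] that by (simp add: y0_def algebra_simps)
    qed (use \<open>t0 \<ge> 0\<close> in auto)
    moreover have "w (\<epsilon> *\<^sub>R (y1 + (1/2) *\<^sub>R (- 2 *\<^sub>R e1)), (t0 + \<epsilon> * (1/4)) + \<epsilon> * (1/2))
        \<le> w (\<epsilon> *\<^sub>R y1, t0 + \<epsilon> * (1/4)) + \<epsilon> * A"
    proof -
      have "w (\<epsilon> *\<^sub>R (y1 + (1/2) *\<^sub>R (- 2 *\<^sub>R e1)), (t0 + \<epsilon> * (1/4)) + \<epsilon> * (1/2))
        \<le> w (\<epsilon> *\<^sub>R y1, t0 + \<epsilon> * (1/4)) + \<epsilon> *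
          integral {0..1/2} (\<lambda>\<sigma>. (norm (- 2 *\<^sub>R e1))\<^sup>2 / (2 * a (y1 + \<sigma> *\<^sub>R (- 2 *\<^sub>R e1))))"
      proof (rule scaled_solution_along_segment[OF w \<epsilon>(1) W a(1) pos])
        show "y1 + \<sigma> *\<^sub>R (- 2 *\<^sub>R e1) \<in> ?W" if "0 \<le> \<sigma>" "\<sigma> \<le> 1/2" for \<sigma>
        proof -
          have "\<bar>1/2 - 2 * \<sigma>\<bar> \<le> 1/2" using that by linarith
          from inW[OF this, of "1/4"] show ?thesis by (simp add: y1_def algebra_simps)
        qed
      qed (use \<open>t0 \<ge> 0\<close> \<epsilon> in auto)
      also have "integral {0..1/2} (\<lambda>\<sigma>. (norm (- 2 *\<^sub>R e1))\<^sup>2 / (2 * a (y1 + \<sigma> *\<^sub>R (- 2 *\<^sub>R e1)))) = A"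
        using detour_integral[OF per a(1) pos cL] unfolding A_def y1_def e1_def by simp
      finally show ?thesis .
    qed
    moreover have "w (\<epsilon> *\<^sub>R (y2 + (1/4) *\<^sub>R e2), (t0 + \<epsilon> * (1/4) + \<epsilon> * (1/2)) + \<epsilon> * (1/4))
        \<le> w (\<epsilon> *\<^sub>R y2, t0 + \<epsilon> * (1/4) + \<epsilon> * (1/2)) + \<epsilon> * (1/4 * (norm e2)\<^sup>2 / 2)"
    proof (rule along)
      show "y2 + \<sigma> *\<^sub>R e2 \<in> ?W" if "0 \<le> \<sigma>" "\<sigma> \<le> 1/4" for \<sigma>
        using inW[of "- (1/2)" "1/4 + \<sigma>"] that by (simp add: y2_def algebra_simps)
    qed (use \<open>t0 \<ge> 0\<close> \<epsilon> in auto)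
    ultimately have "w (\<epsilon> *\<^sub>R y3, t0 + \<epsilon> * (1/4) + \<epsilon> * (1/2) + \<epsilon> * (1/4)) \<le> w (\<epsilon> *\<^sub>R y0, t0) + \<epsilon> * (1/4 + A)"
      unfolding y by (simp add: comp algebra_simps)
    moreover have "w (\<epsilon> *\<^sub>R y0, t0) = f ((real m)\<^sup>2 + 1/2)"
      by (simp add: f_def t0_def y0_def c_def algebra_simps)
    moreover have "w (\<epsilon> *\<^sub>R y3, t0 + \<epsilon> * (1/4) + \<epsilon> * (1/2) + \<epsilon> * (1/4)) = f ((real m)\<^sup>2 - 1/2)"
    proof -
      have "t0 + \<epsilon> * (1/4) + \<epsilon> * (1/2) + \<epsilon> * (1/4) = 1 - \<epsilon> * ((real m)\<^sup>2 - 1/2)"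
        by (simp add: t0_def algebra_simps)
      moreover have "y3 = ((real m)\<^sup>2 - 1/2) *\<^sub>R e1 + (1/2) *\<^sub>R e2"
        by (simp add: y3_def c_def algebra_simps)
      ultimately show ?thesis by (simp add: f_def)
    qed
    ultimately show ?thesis by simp
  qed
  \<comment> \<open>Induction over the detours. Cell 0 keeps its hole, so the base case is half a
    cell of corridor; the corridor after detour \<open>m\<close> has length \<open>2 * m\<close>,
    which is zero at the first step.\<close>
  have chain: "f 0 \<le> f ((real m)\<^sup>2 + 1/2) + \<epsilon> * (((real m)\<^sup>2 + 1/2) / 2 - real m * (1/4 - A))"
    if "\<epsilon> * ((real m)\<^sup>2 + 1/2) \<le> 1" for m
    using that
  proof (induction m)
    case 0
    then show ?case using corridor[of 0 "1/2"] by simp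
  next
    case (Suc m)
    have sq: "(real m)\<^sup>2 + 1/2 \<le> (real (Suc m))\<^sup>2 - 1/2" by (simp add: power2_eq_square algebra_simps)
    define P Q where "P = (real m)\<^sup>2" and "Q = (real (Suc m))\<^sup>2"
    have PQ: "P + 1/2 \<le> Q - 1/2" using sq by (simp add: P_def Q_def)
    have Q: "\<epsilon> * (Q + 1/2) \<le> 1" using Suc.prems by (simp add: Q_def)
    have "\<epsilon> * (Q - 1/2) \<le> \<epsilon> * (Q + 1/2)" using \<epsilon>(1) by (intro mult_left_mono) auto
    then have Q': "\<epsilon> * (Q - 1/2) \<le> 1" using Q by linarith
    have "\<epsilon> * (P + 1/2) \<le> \<epsilon> * (Q - 1/2)" using \<epsilon>(1) PQ by (intro mult_left_mono) auto
    then have P: "\<epsilon> * (P + 1/2) \<le> 1" using Q' by linarith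
    have "f 0 \<le> f (P + 1/2) + \<epsilon> * ((P + 1/2) / 2 - real m * (1/4 - A))"
      using Suc.IH P unfolding P_def by blast
    moreover have "f (P + 1/2) \<le> f (Q - 1/2) + \<epsilon> * ((Q - 1/2 - (P + 1/2)) / 2)"
      by (rule corridor[OF PQ Q'])
    moreover have "f (Q - 1/2) \<le> f (Q + 1/2) + \<epsilon> * (1/4 + A)"
      using detour[of "Suc m"] Q unfolding Q_def by simp
    moreover have "\<epsilon> * ((P + 1/2) / 2 - real m * (1/4 - A)) + \<epsilon> * ((Q - 1/2 - (P + 1/2)) / 2)
        + \<epsilon> * (1/4 + A) = \<epsilon> * ((Q + 1/2) / 2 - real (Suc m) * (1/4 - A))"
      by (simp add: field_simps)
    ultimately show ?case unfolding Q_def[symmetric] by linarith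
  qed
  have "f ((real N)\<^sup>2 + 1/2) \<le> f (1 / \<epsilon>) + \<epsilon> * ((1 / \<epsilon> - ((real N)\<^sup>2 + 1/2)) / 2)"
  proof (rule corridor)
    show "(real N)\<^sup>2 + 1/2 \<le> 1 / \<epsilon>" using \<epsilon> by (simp add: pos_le_divide_eq mult.commute)
  qed (use \<epsilon> in simp)
  moreover have "f (1 / \<epsilon>) = - 1"
  proof -
    have "\<epsilon> *\<^sub>R ((1 / \<epsilon>) *\<^sub>R e1 + (1/2) *\<^sub>R e2) \<in> closure ((\<lambda>y. \<epsilon> *\<^sub>R y) ` ?W)"
      by (rule subsetD[OF closure_subset], rule imageI,
          rule half_integer_mem_perforated[OF D(1), where j = j]) (simp add: comp)
    then have "w (\<epsilon> *\<^sub>R ((1 / \<epsilon>) *\<^sub>R e1 + (1/2) *\<^sub>R e2), 0) = - ((\<epsilon> *\<^sub>R ((1 / \<epsilon>) *\<^sub>R e1 + (1/2) *\<^sub>R e2)) \<bullet> e1)"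
      using w by (simp add: cauchy_solution_def)
    then show ?thesis using \<epsilon>(1) by (simp add: f_def inner_simps comp)
  qed
  moreover have "f 0 = w ((\<epsilon> / 2) *\<^sub>R e2, 1)" by (simp add: f_def)
  moreover have "\<epsilon> * (((real N)\<^sup>2 + 1/2) / 2 - real N * (1/4 - A)) + \<epsilon> * ((1 / \<epsilon> - ((real N)\<^sup>2 + 1/2)) / 2)
      = 1/2 - \<epsilon> * real N * (1/4 - A)"
    using \<epsilon>(1) by (simp add: field_simps)
  ultimately show ?thesis using chain[OF \<epsilon>(2)] by linarith
qed

subsection \<open>Counting cells\<close>

lemma card_truncated_square_cells:
  "card (truncated (square_cells (axis i 1 :: real^'n)) k) = nat \<lfloor>sqrt (real k)\<rfloor>"
proof -
  let ?e = "axis i 1 :: real^'n"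
  have *: "(real m)\<^sup>2 \<le> real k \<longleftrightarrow> m \<le> nat \<lfloor>sqrt (real k)\<rfloor>" for m
  proof -
    have "(real m)\<^sup>2 \<le> real k \<longleftrightarrow> real m \<le> sqrt (real k)"
      by (metis abs_of_nat real_sqrt_abs real_sqrt_le_iff)
    also have "\<dots> \<longleftrightarrow> m \<le> nat \<lfloor>sqrt (real k)\<rfloor>" by (simp add: le_nat_floor le_floor_iff le_nat_iff)
    finally show ?thesis .
  qed
  have box: "(\<forall>l. - real k \<le> (r *\<^sub>R ?e) $ l \<and> (r *\<^sub>R ?e) $ l \<le> real k) \<longleftrightarrow> r \<le> real k"
    if "r \<ge> 0" for r
    using that by (auto simp: axis_def)
  have "truncated (square_cells ?e) k = (\<lambda>m. (real m)\<^sup>2 *\<^sub>R ?e) ` {1..nat \<lfloor>sqrt (real k)\<rfloor>}"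
  proof (intro equalityI subsetI)
    fix x assume "x \<in> truncated (square_cells ?e) k"
    then obtain m where m: "x = (real m)\<^sup>2 *\<^sub>R ?e" "m \<ge> 1"
      and "\<forall>l. - real k \<le> x $ l \<and> x $ l \<le> real k"
      by (auto simp: truncated_def square_cells_def)
    then have "(real m)\<^sup>2 \<le> real k" using box[of "(real m)\<^sup>2"] by simp
    then show "x \<in> (\<lambda>m. (real m)\<^sup>2 *\<^sub>R ?e) ` {1..nat \<lfloor>sqrt (real k)\<rfloor>}"
      using m * by auto
  next
    fix x assume "x \<in> (\<lambda>m. (real m)\<^sup>2 *\<^sub>R ?e) ` {1..nat \<lfloor>sqrt (real k)\<rfloor>}"
    then obtain m where m: "x = (real m)\<^sup>2 *\<^sub>R ?e" "m \<ge> 1" "(real m)\<^sup>2 \<le> real k"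
      using * by auto
    then have "\<forall>l. - real k \<le> x $ l \<and> x $ l \<le> real k" using box[of "(real m)\<^sup>2"] by simp
    then show "x \<in> truncated (square_cells ?e) k"
      using m by (auto simp: truncated_def square_cells_def)
  qed
  moreover have "inj_on (\<lambda>m. (real m)\<^sup>2 *\<^sub>R ?e) A" for A
    by (rule inj_onI) (simp add: axis_eq_0_iff)
  ultimately show ?thesis by (simp add: card_image)
qed

lemma floor_sqrt_asymp_equiv:
  "(\<lambda>k. real (nat \<lfloor>sqrt (real k)\<rfloor>)) \<sim>[at_top] (\<lambda>k. real k powr (1/2))"
proof (rule asymp_equivI')
  have bounds: "1 - 1 / sqrt (real k) \<le> real (nat \<lfloor>sqrt (real k)\<rfloor>) / real k powr (1/2)
      \<and> real (nat \<lfloor>sqrt (real k)\<rfloor>) / real k powr (1/2) \<le> 1" if "k \<ge> 1" for k :: nat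
  proof -
    define s where "s = sqrt (real k)"
    have "s > 0" using that by (simp add: s_def)
    have "real (nat \<lfloor>s\<rfloor>) \<le> s" "s - 1 \<le> real (nat \<lfloor>s\<rfloor>)"
      using \<open>s > 0\<close> by simp_all
    then have "(s - 1) / s \<le> real (nat \<lfloor>s\<rfloor>) / s" "real (nat \<lfloor>s\<rfloor>) / s \<le> 1"
      using \<open>s > 0\<close> by (auto intro: divide_right_mono)
    then show ?thesis
      using \<open>s > 0\<close> by (simp add: powr_half_sqrt diff_divide_distrib s_def)
  qed
  have "filterlim (\<lambda>k::nat. sqrt (real k)) at_top at_top"
    by (rule filterlim_compose[OF sqrt_at_top filterlim_real_sequentially])
  then have "(\<lambda>k::nat. 1 - inverse (sqrt (real k))) \<longlonglongrightarrow> 1 - 0"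
    by (intro tendsto_diff tendsto_const tendsto_inverse_0_at_top)
  then have lower: "(\<lambda>k::nat. 1 - 1 / sqrt (real k)) \<longlonglongrightarrow> 1"
    by (simp add: inverse_eq_divide)
  show "(\<lambda>k. real (nat \<lfloor>sqrt (real k)\<rfloor>) / real k powr (1/2)) \<longlonglongrightarrow> 1"
    by (rule tendsto_sandwich[OF _ _ lower tendsto_const]; rule eventually_sequentiallyI[of 1])
      (simp_all only: bounds)
qed

text \<open>Powers of \<open>k\<close> of the same order have equal exponents, so the count
  determines the exponent and the modulus is characterised, not merely exhibited.\<close>

lemma hole_modulus_square_cells:
  "hole_modulus (square_cells (axis i 1 :: real^'n)) \<omega> \<longleftrightarrow> (\<forall>s>0. \<omega> s = s powr (1/2))"
proof -
  let ?c = "\<lambda>k. real (card (truncated (square_cells (axis i 1 :: real^'n)) k))"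
  have c: "?c \<in> \<Theta>(\<lambda>k. real k powr (1/2))"
    unfolding card_truncated_square_cells
    by (rule asymp_equiv_imp_bigtheta) (rule floor_sqrt_asymp_equiv)
  have unique: "\<theta> = 1/2" if "?c \<in> \<Theta>(\<lambda>k. real k powr \<theta>)" for \<theta>
  proof -
    have "(\<lambda>k. real k powr \<theta>) \<in> \<Theta>(\<lambda>k. real k powr (1/2))"
      using that c by (meson landau_theta.trans bigtheta_sym)
    then show ?thesis by (simp add: powr_bigtheta_iff filterlim_real_sequentially)
  qed
  show ?thesis
  proof
    assume "hole_modulus (square_cells (axis i 1 :: real^'n)) \<omega>"
    then obtain \<theta> where \<theta>: "?c \<in> \<Theta>(\<lambda>k. real k powr \<theta>)" and \<omega>: "\<forall>s>0. \<omega> s = s powr (1 - \<theta>)"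
      unfolding hole_modulus_def by blast
    then show "\<forall>s>0. \<omega> s = s powr (1/2)" using unique[OF \<theta>] by simp
  next
    assume "\<forall>s>0. \<omega> s = s powr (1/2)"
    with c show "hole_modulus (square_cells (axis i 1 :: real^'n)) \<omega>"
      unfolding hole_modulus_def by (intro bexI[of _ "1/2"] conjI) simp_all
  qed
qed

text \<open>The relation between count and modulus even holds with asymptotic constant 1, sharper
  than the order of magnitude in \<open>hole_modulus\<close>.\<close>

lemma card_truncated_ratio_asymp_equiv:
  "(\<lambda>k. real (card (truncated (square_cells (axis i 1 :: real^'n)) k)) / real k)
     \<sim>[at_top] (\<lambda>k. (1 / real k) powr (1/2))"
proof -
  have "(\<lambda>k. real (nat \<lfloor>sqrt (real k)\<rfloor>) / real k) \<sim>[at_top] (\<lambda>k. real k powr (1/2) / real k)"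
    by (intro asymp_equiv_intros floor_sqrt_asymp_equiv)
  also have "(\<lambda>k. real k powr (1/2) / real k) = (\<lambda>k. (1 / real k) powr (1/2))"
    by (rule ext) (simp add: powr_half_sqrt real_sqrt_divide sqrt_divide_self_eq inverse_eq_divide)
  finally show ?thesis unfolding card_truncated_square_cells .
qed

text \<open>The effective Hamiltonian is bounded rather than computed. Every coordinate has another
  one beside it, so the corridor bound holds in each; summing over coordinates gives coercivity with
  constant \<open>1 / CARD('n)\<close>.\<close>

lemma effective_hamiltonian_value:
  fixes a :: "real^'n \<Rightarrow> real" and i j :: 'n
  assumes ij: "i \<noteq> j"
    and H: "effective_hamiltonian (quadratic_hamiltonian a) (perforated D {}) h"
    and u: "cauchy_solution (\<lambda>x p. h p) UNIV (\<lambda>x. - (x \<bullet> axis i 1)) u"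
    and D: "closure D \<subseteq> cube (1/2)" "bounded D"
    and a: "\<And>y. y \<in> closure (perforated D {}) \<Longrightarrow> a y = 1"
  shows "u (x, 1) = - (x \<bullet> axis i 1) - 1/2"
proof (rule eikonal_linear_data_value[OF u])
  have cell: "cell_problem_solvable (quadratic_hamiltonian a) (perforated D {}) p (h p)" for p
    using H by (simp add: effective_hamiltonian_def)
  show "h p \<le> (norm p)\<^sup>2 / 2" for p
    by (rule cell_problem_upper[OF cell D(1) a])
  have comp: "(p $ k)\<^sup>2 / 2 \<le> h p" for p k
  proof -
    obtain l where "k \<noteq> l" using ij by metis
    then show ?thesis by (intro cell_problem_lower[OF cell D]) (rule a)
  qed
  then show "(p \<bullet> axis i 1)\<^sup>2 / 2 \<le> h p" for p by (simp add: inner_axis)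
  show "1 / real CARD('n) * (norm p)\<^sup>2 / 2 \<le> h p" for p
  proof -
    have "(norm p)\<^sup>2 = (\<Sum>k\<in>UNIV. (p $ k)\<^sup>2)"
      by (simp only: power2_norm_eq_inner inner_vec_def) (simp add: power2_eq_square)
    also have "\<dots> \<le> (\<Sum>k\<in>(UNIV::'n set). 2 * h p)"
      using comp[of p] by (intro sum_mono) (simp add: field_simps)
    finally show ?thesis by (simp add: field_simps)
  qed
qed auto

section \<open>The number of detours and the final estimate\<close>

lemma exists_cell_count:
  assumes "0 < \<epsilon>" "\<epsilon> < 1/4"
  obtains N :: nat where "\<epsilon> * ((real N)\<^sup>2 + 1/2) \<le> 1" "\<epsilon> powr (1/2) / 4 \<le> \<epsilon> * real N"
proof -
  define r where "r = sqrt \<epsilon>"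
  have r: "0 < r" "r < 1/2" "r * r = \<epsilon>"
    using assms real_sqrt_less_mono[of \<epsilon> "1/4"] by (auto simp: r_def real_sqrt_divide)
  define t where "t = 1 / r"
  have t: "t > 2" "r * t = 1" using r by (auto simp: t_def field_simps)
  \<comment> \<open>The shift by 1/4 makes room for the half cell:
    \<open>(t - 1/4)\<^sup>2 \<le> t\<^sup>2 - 1/2\<close>. Rounding leaves at least
    \<open>t - 5/4\<close>, which exceeds \<open>t / 4\<close> because \<open>t > 2\<close>.\<close>
  define N where "N = nat \<lfloor>t - 1/4\<rfloor>"
  have N: "real N \<le> t - 1/4" "t - 5/4 \<le> real N"
    using t by (simp_all add: N_def) linarith+
  have "(real N)\<^sup>2 \<le> (t - 1/4)\<^sup>2" using N by (intro power_mono) auto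
  also have "\<dots> \<le> t\<^sup>2 - 1/2" using t by (simp add: power2_eq_square algebra_simps)
  finally have "\<epsilon> * ((real N)\<^sup>2 + 1/2) \<le> \<epsilon> * t\<^sup>2"
    using assms by (intro mult_left_mono) auto
  also have "\<epsilon> * t\<^sup>2 = (r * t) * (r * t)" using r(3) by (simp add: power2_eq_square algebra_simps flip: r(3))
  finally have 1: "\<epsilon> * ((real N)\<^sup>2 + 1/2) \<le> 1" using t by simp
  have "\<epsilon> * (t / 4) \<le> \<epsilon> * real N"
    using N t assms by (intro mult_left_mono) auto
  moreover have "\<epsilon> * (t / 4) = r / 4" using t r by (simp add: t_def flip: r(3))
  moreover have "r = \<epsilon> powr (1/2)" using assms by (simp add: powr_half_sqrt r_def)
  ultimately have 2: "\<epsilon> powr (1/2) / 4 \<le> \<epsilon> * real N" by simp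
  show ?thesis by (rule that[OF 1 2])
qed

text \<open>Since \<open>\<delta>\<close> is chosen before \<open>D\<close>, it depends on
  \<open>a\<close> and the two directions alone. Two distinct basis vectors encode dimension at
  least 2.\<close>

theorem lemma6p4:
  fixes a :: "real^'n \<Rightarrow> real" and e1 e2 :: "real^'n"
  assumes basis: "e1 \<in> Basis" "e2 \<in> Basis" "e1 \<noteq> e2"
    and a_cont: "continuous_on UNIV a"
    and a_periodic: "\<forall>m\<in>integer_lattice. \<forall>y. a (y + m) = a y"
    and a_integral: "integral {-1/2..1/2} (\<lambda>s. 1 / a ((1/4) *\<^sub>R e2 + s *\<^sub>R e1)) < 1/4"
  shows "(\<forall>\<omega>. hole_modulus (square_cells e1) \<omega> \<longleftrightarrow> (\<forall>s>0. \<omega> s = s powr (1/2)))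
    \<and> (\<lambda>k. real (card (truncated (square_cells e1) k)) / real k)
         \<sim>[at_top] (\<lambda>k. (1 / real k) powr (1/2))
    \<and> (\<exists>\<delta>>0. \<forall>D.
         open D \<and> connected D \<and> C1_boundary D
         \<and> compactly_contained (cube (9/20)) D \<and> compactly_contained D (cube (1/2))
         \<and> connected (perforated D {})
         \<and> (\<forall>y\<in>closure (perforated D {}). a y = 1)
         \<and> (\<forall>y. y \<notin> closure (perforated D {}) \<longrightarrow> a y > 1)
       \<longrightarrow> (\<forall>Hbar u.
         effective_hamiltonian (quadratic_hamiltonian a) (perforated D {}) Hbar
         \<and> cauchy_solution (\<lambda>x p. Hbar p) UNIV (\<lambda>x. - (x \<bullet> e1)) u
       \<longrightarrow> (\<forall>\<epsilon>\<in>{0<..<1/4}. \<forall>w.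
         cauchy_solution (\<lambda>x p. quadratic_hamiltonian a (x /\<^sub>R \<epsilon>) p)
           ((\<lambda>y. \<epsilon> *\<^sub>R y) ` perforated D (square_cells e1)) (\<lambda>x. - (x \<bullet> e1)) w
       \<longrightarrow> w ((\<epsilon> / 2) *\<^sub>R e2, 1)
             \<le> u ((\<epsilon> / 2) *\<^sub>R e2, 1) - \<delta> * \<epsilon> powr (1/2) + \<epsilon>
         \<and> u ((\<epsilon> / 2) *\<^sub>R e2, 1) - \<delta> * \<epsilon> powr (1/2) + \<epsilon>
             = - 1/2 - \<delta> * \<epsilon> powr (1/2) + \<epsilon>)))"
proof -
  obtain i j where e: "e1 = axis i 1" "e2 = axis j 1"
    using basis by (auto simp: Basis_vec_def)
  then have ij: "i \<noteq> j" using basis(3) by auto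
  define A where "A = integral {-1/2..1/2} (\<lambda>s. 1 / a ((1/4) *\<^sub>R e2 + s *\<^sub>R e1))"
  \<comment> \<open>The saving per detour is \<open>1/4 - A\<close> in units of
    \<open>\<epsilon>\<close>; the divisor 4 comes from the lower bound
    \<open>\<epsilon> powr (1/2) / 4\<close> for \<open>\<epsilon> * real N\<close>.\<close>
  define \<delta> where "\<delta> = (1/4 - A) / 4"
  have A: "A < 1/4" using a_integral by (simp add: A_def)
  then have "\<delta> > 0" by (simp add: \<delta>_def)
  have bound: "w ((\<epsilon> / 2) *\<^sub>R e2, 1) \<le> u ((\<epsilon> / 2) *\<^sub>R e2, 1) - \<delta> * \<epsilon> powr (1/2) + \<epsilon>
      \<and> u ((\<epsilon> / 2) *\<^sub>R e2, 1) = - 1/2"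
    if D: "compactly_contained D (cube (1/2))"
      and a1: "\<And>y. y \<in> closure (perforated D {}) \<Longrightarrow> a y = 1"
      and a2: "\<And>y. y \<notin> closure (perforated D {}) \<Longrightarrow> a y > 1"
      and H: "effective_hamiltonian (quadratic_hamiltonian a) (perforated D {}) Hbar"
      and u: "cauchy_solution (\<lambda>x p. Hbar p) UNIV (\<lambda>x. - (x \<bullet> e1)) u"
      and \<epsilon>: "0 < \<epsilon>" "\<epsilon> < 1/4"
      and w: "cauchy_solution (\<lambda>x p. quadratic_hamiltonian a (x /\<^sub>R \<epsilon>) p)
        ((\<lambda>y. \<epsilon> *\<^sub>R y) ` perforated D (square_cells e1)) (\<lambda>x. - (x \<bullet> e1)) w"
    for D Hbar u \<epsilon> w
  proof -
    note D' = compactly_contained_cube[OF D]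
    have "a y \<ge> 1" for y using a1[of y] a2[of y] by (cases "y \<in> closure (perforated D {})") auto
    note path = detour_path_upper_bound[OF ij w[unfolded e] D' a_cont this a_periodic \<epsilon>(1),
        folded e, folded A_def]
    obtain N :: nat where N: "\<epsilon> * ((real N)\<^sup>2 + 1/2) \<le> 1" "\<epsilon> powr (1/2) / 4 \<le> \<epsilon> * real N"
      using exists_cell_count[OF \<epsilon>] by blast
    have "\<delta> * \<epsilon> powr (1/2) = (\<epsilon> powr (1/2) / 4) * (1/4 - A)" by (simp add: \<delta>_def)
    also have "\<dots> \<le> \<epsilon> * real N * (1/4 - A)" using N(2) A by (intro mult_right_mono) auto
    finally have "w ((\<epsilon> / 2) *\<^sub>R e2, 1) \<le> - 1/2 - \<delta> * \<epsilon> powr (1/2)"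
      using path[OF N(1)] by linarith
    moreover have "e2 \<bullet> e1 = 0" using ij by (simp add: e inner_axis_axis)
    then have "u ((\<epsilon> / 2) *\<^sub>R e2, 1) = - 1/2"
      using effective_hamiltonian_value[OF ij H u[unfolded e] D' a1, of "(\<epsilon> / 2) *\<^sub>R e2"]
      by (simp flip: e)
    ultimately show ?thesis using \<epsilon> by linarith
  qed
  show ?thesis
  proof (intro conjI)
    show "\<forall>\<omega>. hole_modulus (square_cells e1) \<omega> \<longleftrightarrow> (\<forall>s>0. \<omega> s = s powr (1/2))"
      by (simp add: e hole_modulus_square_cells)
    show "(\<lambda>k. real (card (truncated (square_cells e1) k)) / real k)
         \<sim>[at_top] (\<lambda>k. (1 / real k) powr (1/2))"
      unfolding e by (rule card_truncated_ratio_asymp_equiv)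
  qed (use \<open>\<delta> > 0\<close> bound in \<open>auto intro!: exI[of _ \<delta>]\<close>)
qed

end
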